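(* Assume that $F\in\mathcal{S}(\Omega)$ has an $s$-horseshoe. Then the topological entropy of $F$ satisfies $h(F)\ge\log(s)$.
   Context: Let $\mathbb{S}^1=\mathbb{R}/\mathbb{Z}$, $\mathbb{I}=[0,1]$, $\Omega=\mathbb{S}^1\times\mathbb{I}$, and let $\pi:\Omega\to\mathbb{S}^1$ be the projection. $\mathcal{S}(\Omega)$ is the class of all maps $F:\Omega\to\Omega$ of the form $F(\theta,x)=(R_\omega(\theta),f(\theta,x))$, where $R_\omega(\theta)=\theta+\omega \pmod 1$ with $\omega\in\mathbb{R}\setminus\mathbb{Q}$ and $f:\Omega\to\mathbb{I}$ is continuous. $h(F)$ denotes topological entropy. A set is residual if it contains the intersection of a countable family of open dense sets. A strip is a closed set $B\subset\Omega$ with $\pi(B)=\mathbb{S}^1$ such that $\pi^{-1}(\theta)\cap B$ is a closed interval (possibly a point) for every $\theta$ in a residual subset of $\mathbb{S}^1$. The core of $A\subset\Omega$ is $A^c=\bigcap_{G}\overline{A\cap\pi^{-1}(G)}$, the intersection being over all residual $G\subset\mathbb{S}^1$. A band is a strip $A$ with $A^c=A$. For a strip $A$ put $M_A(\theta)=\max\{x:(\theta,x)\in A\}$ and $m_A(\theta)=\min\{x:(\theta,x)\in A\}$; the sets $G_{M_A}$ and $G_{m_A}$ of continuity points of $M_A$ and $m_A$ are residual. The top cover of $A$ is $A^+=\overline{\{(\theta,M_A(\theta)):\theta\in G_{M_A}\}}$ and the bottom cover is $A^-=\overline{\{(\theta,m_A(\theta)):\theta\in G_{m_A}\}}$. For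 strips $A,B$ write $A\le B$ (equivalently $B\ge A$) if there is a residual set $G\subset\mathbb{S}^1$ with $M_A(\theta)\le m_B(\theta)$ for all $\theta\in G$; $A,B$ are weakly ordered if $A\le B$ or $A\ge B$. For bands $A,B$, $A$ $F$-covers $B$ if either $F(A^-)\le B^-$ and $F(A^+)\ge B^+$, or $F(A^-)\ge B^+$ and $F(A^+)\le B^-$. An $s$-horseshoe for $F$ is a pair $(J,\mathcal{D})$ where $J$ is a band and $\mathcal{D}$ is a set of $s\ge2$ pairwise weakly ordered bands, each of them with non-empty interior, such that $L$ $F$-covers $J$ for every $L\in\mathcal{D}$.
   Formalization: The formal definition of an s-horseshoe additionally requires every band L in D to be contained in J; without this containment the statement is false (two bands disjoint from J can both F-cover J while h(F)=0). *)

theory Defs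
  imports "HOL-Analysis.Analysis"
begin

section \<open>The circle and the cylinder\<close>

quotient_type circle = real / "\<lambda>x y. x - y \<in> \<int>"
proof (intro equivpI reflpI sympI transpI)
  show "x - x \<in> \<int>" for x :: real
    by simp
  show "y - x \<in> \<int>" if "x - y \<in> \<int>" for x y :: real
    using Ints_minus[OF that] by simp
  show "x - z \<in> \<int>" if "x - y \<in> \<int>" "y - z \<in> \<int>" for x y z :: real
    using Ints_add[OF that] by simp
qed

instantiation circle :: topological_space
begin

definition open_circle :: "circle set \<Rightarrow> bool"
  where "open_circle U \<longleftrightarrow> open (abs_circle -` U)"

instance
  by standard (auto simp: open_circle_def vimage_Union intro: open_UN open_Int)

end

instance circle :: t2_space
proof
  fix p q :: circle
  assume "p \<noteq> q"
  obtain x y where p: "p = abs_circle x" and q: "q = abs_circle y"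
    by (metis circle.abs_eq_iff Quotient3_abs_rep Quotient3_circle)
  define d where "d = \<bar>(x - y) - of_int (round (x - y))\<bar>"
  have "x - y \<notin> \<int>"
    using \<open>p \<noteq> q\<close> by (simp add: p q circle.abs_eq_iff)
  then have "x - y \<noteq> of_int (round (x - y))"
    by (metis Ints_of_int)
  then have d: "d > 0"
    by (simp add: d_def)
  define N where "N = (\<lambda>z::real. {c. \<exists>t. c = abs_circle t \<and> \<bar>t - z\<bar> < d / 2})"
  have vim: "abs_circle -` N z = (\<Union>n. ball (z + of_int n) (d / 2))" for z
  proof (intro equalityI subsetI)
    fix w assume "w \<in> abs_circle -` N z"
    then obtain t where t: "w - t \<in> \<int>" "\<bar>t - z\<bar> < d / 2"
      by (auto simp: N_def circle.abs_eq_iff)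
    then obtain n where "w - t = of_int n"
      by (auto elim: Ints_cases)
    with t(2) have "w \<in> ball (z + of_int n) (d / 2)"
      unfolding mem_ball dist_real_def by linarith
    then show "w \<in> (\<Union>n. ball (z + of_int n) (d / 2))"
      by blast
  next
    fix w assume "w \<in> (\<Union>n. ball (z + of_int n) (d / 2))"
    then obtain n where "\<bar>z + of_int n - w\<bar> < d / 2"
      by (auto simp: dist_real_def)
    then have "\<bar>(w - of_int n) - z\<bar> < d / 2"
      by linarith
    moreover have "abs_circle w = abs_circle (w - of_int n)"
      by (simp add: circle.abs_eq_iff)
    ultimately show "w \<in> abs_circle -` N z"
      by (auto simp: N_def)
  qed
  have "open (N z)" for z
    unfolding open_circle_def vim by blast
  moreover have "abs_circle z \<in> N z" for z
    using d unfolding N_def by (intro CollectI exI[of _ z]) simp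
  then have "p \<in> N x" "q \<in> N y"
    by (simp_all add: p q)
  moreover have "N x \<inter> N y = {}"
  proof (rule ccontr)
    assume "N x \<inter> N y \<noteq> {}"
    then obtain t u where tu: "t - u \<in> \<int>" "\<bar>t - x\<bar> < d / 2" "\<bar>u - y\<bar> < d / 2"
      by (auto simp: N_def circle.abs_eq_iff)
    then obtain n where "t - u = of_int n"
      by (auto elim: Ints_cases)
    with tu have "\<bar>(x - y) - of_int n\<bar> < d"
      by linarith
    moreover have "d \<le> \<bar>(x - y) - of_int n\<bar>"
      unfolding d_def using round_diff_minimal[of "x - y" n] by (simp add: abs_minus_commute)
    ultimately show False
      by simp
  qed
  ultimately show "\<exists>U V. open U \<and> open V \<and> p \<in> U \<and> q \<in> V \<and> U \<inter> V = {}"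
    by blast
qed

lift_definition rotation :: "real \<Rightarrow> circle \<Rightarrow> circle"
  is "\<lambda>\<omega> \<theta>. \<theta> + \<omega>"
  by simp

definition Omega :: "(circle \<times> real) set"
  where "Omega = UNIV \<times> {0..1}"

text \<open>Maps of the cylinder are total functions on \<^typ>\<open>circle \<times> real\<close>; their values outside
  \<^const>\<open>Omega\<close> are irrelevant.\<close>

definition skew_products :: "(circle \<times> real \<Rightarrow> circle \<times> real) set"
  where "skew_products = {F. \<exists>\<omega> f. \<omega> \<notin> \<rat> \<and> continuous_on Omega f \<and> f ` Omega \<subseteq> {0..1} \<and>
    (\<forall>\<theta>. \<forall>x\<in>{0..1}. F (\<theta>, x) = (rotation \<omega> \<theta>, f (\<theta>, x)))}"

section \<open>Topological entropy\<close>

text \<open>The definition by open covers, due to Adler, Konheim and McAndrew, for a continuous self-map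
  \<open>T\<close> of a compact space \<open>X\<close>. The sequence whose upper limit is taken converges in that case, by
  subadditivity.\<close>

definition open_cover :: "'a topology \<Rightarrow> 'a set set \<Rightarrow> bool"
  where "open_cover X \<U> \<longleftrightarrow> (\<forall>U\<in>\<U>. openin X U) \<and> \<Union>\<U> = topspace X"

definition cover_number :: "'a topology \<Rightarrow> 'a set set \<Rightarrow> nat"
  where "cover_number X \<U> =
    (LEAST n. \<exists>\<V>\<subseteq>\<U>. finite \<V> \<and> card \<V> = n \<and> \<Union>\<V> = topspace X)"

definition iterated_cover :: "'a topology \<Rightarrow> ('a \<Rightarrow> 'a) \<Rightarrow> nat \<Rightarrow> 'a set set \<Rightarrow> 'a set set"
  where "iterated_cover X T n \<U> =
    {{x \<in> topspace X. \<forall>i<n. (T ^^ i) x \<in> U i} | U. \<forall>i<n. U i \<in> \<U>}"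

definition cover_entropy :: "'a topology \<Rightarrow> ('a \<Rightarrow> 'a) \<Rightarrow> 'a set set \<Rightarrow> ereal"
  where "cover_entropy X T \<U> =
    limsup (\<lambda>n. ereal (ln (real (cover_number X (iterated_cover X T n \<U>))) / real n))"

definition topological_entropy :: "'a topology \<Rightarrow> ('a \<Rightarrow> 'a) \<Rightarrow> ereal"
  where "topological_entropy X T = (SUP \<U>\<in>{\<U>. open_cover X \<U>}. cover_entropy X T \<U>)"

section \<open>Strips and bands\<close>

definition residual :: "'a::topological_space set \<Rightarrow> bool"
  where "residual G \<longleftrightarrow>
    (\<exists>\<U>. countable \<U> \<and> (\<forall>U\<in>\<U>. open U \<and> closure U = UNIV) \<and> \<Inter>\<U> \<subseteq> G)"

definition strip :: "(circle \<times> real) set \<Rightarrow> bool"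
  where "strip B \<longleftrightarrow> B \<subseteq> Omega \<and> closed B \<and> fst ` B = UNIV \<and>
    (\<exists>G. residual G \<and> (\<forall>\<theta>\<in>G. \<exists>a b. a \<le> b \<and> {x. (\<theta>, x) \<in> B} = {a..b}))"

definition core :: "(circle \<times> real) set \<Rightarrow> (circle \<times> real) set"
  where "core A = (\<Inter>G\<in>{G. residual G}. closure (A \<inter> fst -` G))"

definition band :: "(circle \<times> real) set \<Rightarrow> bool"
  where "band A \<longleftrightarrow> strip A \<and> core A = A"

definition upper :: "(circle \<times> real) set \<Rightarrow> circle \<Rightarrow> real"
  where "upper A \<theta> = (GREATEST x. (\<theta>, x) \<in> A)"

definition lower :: "(circle \<times> real) set \<Rightarrow> circle \<Rightarrow> real"
  where "lower A \<theta> = (LEAST x. (\<theta>, x) \<in> A)"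

definition top_cover :: "(circle \<times> real) set \<Rightarrow> (circle \<times> real) set"
  where "top_cover A = closure {(\<theta>, upper A \<theta>) | \<theta>. isCont (upper A) \<theta>}"

definition bottom_cover :: "(circle \<times> real) set \<Rightarrow> (circle \<times> real) set"
  where "bottom_cover A = closure {(\<theta>, lower A \<theta>) | \<theta>. isCont (lower A) \<theta>}"

definition strip_le :: "(circle \<times> real) set \<Rightarrow> (circle \<times> real) set \<Rightarrow> bool"
  where "strip_le A B \<longleftrightarrow> (\<exists>G. residual G \<and> (\<forall>\<theta>\<in>G. upper A \<theta> \<le> lower B \<theta>))"

definition weakly_ordered :: "(circle \<times> real) set \<Rightarrow> (circle \<times> real) set \<Rightarrow> bool"
  where "weakly_ordered A B \<longleftrightarrow> strip_le A B \<or> strip_le B A"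

section \<open>Horseshoes\<close>

definition band_covers ::
    "(circle \<times> real \<Rightarrow> circle \<times> real) \<Rightarrow> (circle \<times> real) set \<Rightarrow> (circle \<times> real) set \<Rightarrow> bool"
  where "band_covers F A B \<longleftrightarrow>
    strip_le (F ` bottom_cover A) (bottom_cover B) \<and> strip_le (top_cover B) (F ` top_cover A) \<or>
    strip_le (top_cover B) (F ` bottom_cover A) \<and> strip_le (F ` top_cover A) (bottom_cover B)"

text \<open>As for horseshoes of interval maps, the members of \<open>\<D>\<close> are subsets of \<open>J\<close>. Without this,
  a horseshoe would not force positive entropy: let \<open>F (\<theta>, x) = (rotation \<omega> \<theta>, g x)\<close>, where
  \<open>g\<close> vanishes on \<open>[0, 1/2]\<close>, is affine on \<open>[1/2, 3/4]\<close> and on \<open>[3/4, 1]\<close>, and satisfies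
  \<open>g (3/4) = 1/4\<close> and \<open>g 1 = 0\<close>. The bands over \<open>[1/2, 3/4]\<close> and \<open>[3/4, 1]\<close> both cover the band
  over \<open>[0, 1/4]\<close>, but \<open>F \<circ> F\<close> maps the cylinder to the invariant circle at height \<open>0\<close>, so that
  \<open>F\<close> has entropy \<open>0\<close>.\<close>

definition horseshoe ::
    "(circle \<times> real \<Rightarrow> circle \<times> real) \<Rightarrow> nat \<Rightarrow> (circle \<times> real) set \<Rightarrow> (circle \<times> real) set set \<Rightarrow> bool"
  where "horseshoe F s J \<D> \<longleftrightarrow>
    band J \<and> s \<ge> 2 \<and> card \<D> = s \<and> pairwise weakly_ordered \<D> \<and>
    (\<forall>L\<in>\<D>. band L \<and> top_of_set Omega interior_of L \<noteq> {} \<and> L \<subseteq> J \<and> band_covers F L J)"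

end

theory Submission
  imports Defs
begin

text \<open>
  Over a residual set of base points, invariant under the rotation, all the extremal functions
  involved are continuous, so the covering relations and the order of the bands become statements
  about the compact intervals between lower and upper ends of fibres, to which the theory of
  interval horseshoes applies. Minimality of the rotation and uniform continuity along the fibres
  bound the length of the fibres of \<open>J\<close> from below. Hence the \<open>s\<^sup>n\<close> intervals of itineraries of
  length \<open>n\<close> have length at least some \<open>\<eta> n > 0\<close>, and by keeping every other one we obtain at
  least \<open>s\<^sup>n / 2\<close> intervals with gaps \<open>\<eta> n\<close>. Iterating over blocks of length \<open>n\<close> shows that
  the entropy is at least \<open>(n ln s - ln 2) / n\<close>, for each \<open>n\<close>.
\<close>

section \<open>The circle and its rotations\<close>

text \<open>Intervals of different itineraries have disjoint interiors but may share end points, and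
  a common end point cannot count twice. The gaps repair this at the price of a factor 2. That
  factor is paid once per block, so it lowers the exponential rate by \<open>ln 2 / n\<close> only,
  which vanishes as the block length \<open>n\<close> grows. The obstacle is uniformity. The entropy
  of a cover is a limit over orbit lengths with the cover held fixed, so one gap has to serve all
  blocks, although successive blocks start over different base points. Positive length of each fibre
  of \<open>J\<close> separately would not give this: the lengths could tend to 0 along the orbit. A
  lower bound on all generic fibres, together with a modulus of continuity independent of the base
  point, makes the gap depend on \<open>n\<close> alone. In the end a single generic base point and
  its forward orbit carry all the separated points. Genericity matters because the fibre of a top or
  bottom cover is certain to be just the end point of the fibre of the band only where the extremal
  function is continuous.\<close>

lemma circle_cases:
  obtains t where "\<theta> = abs_circle t" "0 \<le> t" "t \<le> 1"
proof -
  obtain r where r: "\<theta> = abs_circle r"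
    by (metis Quotient3_abs_rep Quotient3_circle)
  then have "\<theta> = abs_circle (frac r)"
    by (simp add: circle.abs_eq_iff frac_def)
  then show thesis
    using that[of "frac r"] by (simp add: less_imp_le[OF frac_lt_1])
qed

lemma continuous_on_abs_circle: "continuous_on S abs_circle"
proof -
  have "open (abs_circle -` B)" if "open B" for B
    using that by (simp add: open_circle_def)
  then have "continuous_on UNIV abs_circle"
    by (simp add: continuous_on_open_vimage)
  then show ?thesis
    by (rule continuous_on_subset) simp
qed

text \<open>The saturation of \<open>U\<close> is the union of its integer translates. Openness of
  the quotient map is what lets density be pulled back to the real line.\<close>

lemma open_abs_circle_image:
  assumes "open U"
  shows "open (abs_circle ` U)"
proof -
  have "abs_circle -` abs_circle ` U = (\<Union>n::int. (\<lambda>x. of_int n + x) ` U)"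
  proof (intro equalityI subsetI)
    fix w assume "w \<in> abs_circle -` abs_circle ` U"
    then obtain u where "u \<in> U" "w - u \<in> \<int>"
      by (auto simp: circle.abs_eq_iff)
    then obtain n where "w - u = of_int n"
      by (auto elim: Ints_cases)
    then have "w = of_int n + u"
      by simp
    with \<open>u \<in> U\<close> show "w \<in> (\<Union>n::int. (\<lambda>x. of_int n + x) ` U)"
      by blast
  next
    fix w assume "w \<in> (\<Union>n::int. (\<lambda>x. of_int n + x) ` U)"
    then obtain n :: int and u where "u \<in> U" "w = of_int n + u"
      by blast
    then have "abs_circle w = abs_circle u"
      by (simp add: circle.abs_eq_iff)
    with \<open>u \<in> U\<close> show "w \<in> abs_circle -` abs_circle ` U"
      by simp
  qed
  moreover have "open ((\<lambda>x. of_int n + x) ` U)" for n :: int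
    using assms by (rule open_translation)
  ultimately show ?thesis
    by (simp add: open_circle_def open_UN)
qed

lemma compact_UNIV_circle: "compact (UNIV :: circle set)"
proof -
  have "(UNIV :: circle set) = abs_circle ` {0..1}"
  proof (intro equalityI subsetI)
    fix \<theta> :: circle
    show "\<theta> \<in> abs_circle ` {0..1}"
      by (rule circle_cases[of \<theta>]) auto
  qed simp
  then show ?thesis
    by (metis compact_continuous_image continuous_on_abs_circle compact_Icc)
qed

lemma rotation_add: "rotation a (rotation b \<theta>) = rotation (a + b) \<theta>"
  by transfer (simp add: algebra_simps)

lemma rotation_0 [simp]: "rotation 0 \<theta> = \<theta>"
  by transfer simp

lemma rotation_inverse [simp]:
  "rotation (- a) (rotation a \<theta>) = \<theta>" "rotation a (rotation (- a) \<theta>) = \<theta>"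
  by (simp_all add: rotation_add)

lemma open_vimage_rotation:
  assumes "open U"
  shows "open (rotation a -` U)"
proof -
  have "abs_circle -` rotation a -` U = (\<lambda>t. t + a) -` abs_circle -` U"
    by (auto simp: rotation.abs_eq)
  moreover have "open (abs_circle -` U)"
    using assms by (simp add: open_circle_def)
  ultimately show ?thesis
    by (simp add: open_circle_def open_vimage continuous_intros)
qed

lemma image_rotation: "rotation a ` S = rotation (- a) -` S"
proof (intro equalityI subsetI)
  fix \<theta> assume "\<theta> \<in> rotation (- a) -` S"
  then have "rotation a (rotation (- a) \<theta>) \<in> rotation a ` S"
    by blast
  then show "\<theta> \<in> rotation a ` S"
    by simp
qed auto

text \<open>Minimality of the rotation, lifted to the real line: the multiples of an irrational
  \<open>\<omega>\<close> are dense modulo 1.\<close>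

lemma rotation_orbit_meets_open:
  assumes "\<omega> \<notin> \<rat>" "open V" "V \<noteq> {}"
  shows "\<exists>k::nat. rotation (real k * \<omega>) \<theta> \<in> V"
proof -
  obtain t where t: "\<theta> = abs_circle t"
    by (rule circle_cases)
  from \<open>V \<noteq> {}\<close> obtain \<psi> where "\<psi> \<in> V"
    by blast
  obtain r where r: "\<psi> = abs_circle r"
    by (rule circle_cases)
  have "open (abs_circle -` V)" "r \<in> abs_circle -` V"
    using \<open>open V\<close> \<open>\<psi> \<in> V\<close> by (simp_all add: open_circle_def r)
  then obtain e where e: "e > 0" "ball r e \<subseteq> abs_circle -` V"
    by (meson openE)
  \<comment> \<open>The displacement to be approximated leads from the given point \<open>t\<close>
    to a point \<open>r\<close> over \<open>V\<close>. Positivity of \<open>k\<close> makes this a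
    forward iterate, so that \<open>nat k\<close> changes nothing.\<close>
  obtain h k where hk: "k > 0" "\<bar>of_int k * \<omega> - of_int h - (r - t)\<bar> < e"
    using sequence_of_fractional_parts_is_dense[OF assms(1) e(1), of "r - t"] by blast
  then have "t + of_int k * \<omega> - of_int h \<in> ball r e"
    unfolding mem_ball dist_real_def by linarith
  then have "abs_circle (t + of_int k * \<omega> - of_int h) \<in> V"
    using e(2) by blast
  moreover have "abs_circle (t + of_int k * \<omega> - of_int h) = rotation (real (nat k) * \<omega>) \<theta>"
    using hk(1) by (simp add: t rotation.abs_eq circle.abs_eq_iff)
  ultimately show ?thesis
    by metis
qed

text \<open>Compactness: finitely many of the open sets of points that enter \<open>V\<close> at
  time \<open>k\<close> already cover the circle.\<close>

lemma rotation_uniform_hitting_time: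
  assumes "\<omega> \<notin> \<rat>" "open V" "V \<noteq> {}"
  shows "\<exists>N::nat. \<forall>\<theta>. \<exists>k\<le>N. rotation (real k * \<omega>) \<theta> \<in> V"
proof -
  let ?C = "\<lambda>k::nat. rotation (real k * \<omega>) -` V"
  have "UNIV \<subseteq> (\<Union>k. ?C k)"
    using rotation_orbit_meets_open[OF assms] by blast
  then obtain K where K: "finite K" "UNIV \<subseteq> (\<Union>k\<in>K. ?C k)"
    using compactE_image[OF compact_UNIV_circle, of UNIV ?C] open_vimage_rotation[OF assms(2)]
    by metis
  show ?thesis
  proof (rule exI, rule allI)
    fix \<theta>
    obtain k where "k \<in> K" "rotation (real k * \<omega>) \<theta> \<in> V"
      using K(2) by blast
    with K(1) show "\<exists>k\<le>Max K. rotation (real k * \<omega>) \<theta> \<in> V"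
      by (intro exI[of _ k]) simp
  qed
qed

section \<open>Residual sets\<close>

lemma residual_mono: "residual G \<Longrightarrow> G \<subseteq> H \<Longrightarrow> residual H"
  unfolding residual_def by (elim exE conjE, intro exI conjI) (assumption+, rule order_trans)

lemma residual_INT:
  assumes "countable I" "\<And>i. i \<in> I \<Longrightarrow> residual (G i)"
  shows "residual (\<Inter>i\<in>I. G i)"
proof -
  have "\<forall>i\<in>I. \<exists>\<U>. countable \<U> \<and> (\<forall>U\<in>\<U>. open U \<and> closure U = UNIV) \<and> \<Inter>\<U> \<subseteq> G i"
    using assms(2) unfolding residual_def by blast
  from bchoice[OF this] obtain \<U> where "\<forall>i\<in>I.
      countable (\<U> i) \<and> (\<forall>U\<in>\<U> i. open U \<and> closure U = UNIV) \<and> \<Inter>(\<U> i) \<subseteq> G i" ..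
  then have \<U>: "countable (\<U> i)" "\<And>U. U \<in> \<U> i \<Longrightarrow> open U" "\<And>U. U \<in> \<U> i \<Longrightarrow> closure U = UNIV"
      "\<Inter>(\<U> i) \<subseteq> G i" if "i \<in> I" for i
    using that by simp_all
  show ?thesis
    unfolding residual_def
  proof (intro exI[of _ "\<Union>i\<in>I. \<U> i"] conjI ballI)
    show "countable (\<Union>i\<in>I. \<U> i)"
      using assms(1) \<U> by auto
    show "open U" "closure U = UNIV" if "U \<in> (\<Union>i\<in>I. \<U> i)" for U
      using that \<U> by auto
    show "\<Inter>(\<Union>i\<in>I. \<U> i) \<subseteq> (\<Inter>i\<in>I. G i)"
    proof (intro subsetI INT_I)
      fix x i assume "x \<in> \<Inter>(\<Union>i\<in>I. \<U> i)" "i \<in> I"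
      then have "x \<in> \<Inter>(\<U> i)"
        by blast
      with \<U> \<open>i \<in> I\<close> show "x \<in> G i"
        by blast
    qed
  qed
qed

lemma residual_Int: "residual G \<Longrightarrow> residual H \<Longrightarrow> residual (G \<inter> H)"
  using residual_INT[of UNIV "\<lambda>b. if b then G else H"] by (simp add: UNIV_bool Int_commute)

text \<open>A rotation is a homeomorphism, so it pulls dense open sets back to dense open
  sets.\<close>

lemma residual_vimage_rotation:
  assumes "residual G"
  shows "residual (rotation a -` G)"
proof -
  obtain \<U> where \<U>: "countable \<U>" "\<forall>U\<in>\<U>. open U \<and> closure U = UNIV" "\<Inter>\<U> \<subseteq> G"
    using assms unfolding residual_def by blast
  have dense: "closure (rotation a -` U) = UNIV" if "closure U = UNIV" for U
  proof -
    have "\<theta> \<in> closure (rotation a -` U)" for \<theta>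
      unfolding closure_iff_nhds_not_empty
    proof (intro allI impI)
      fix A W assume "W \<subseteq> A" "open W" "\<theta> \<in> W"
      then have "rotation a ` W \<inter> U \<noteq> {}"
        using that open_vimage_rotation[of W "- a"]
        by (metis empty_iff image_eqI image_rotation inf_top.right_neutral open_Int_closure_eq_empty)
      then show "rotation a -` U \<inter> A \<noteq> {}"
        using \<open>W \<subseteq> A\<close> by blast
    qed
    then show ?thesis
      by blast
  qed
  show ?thesis
    unfolding residual_def
  proof (intro exI[of _ "(-`) (rotation a) ` \<U>"] conjI)
    show "countable ((-`) (rotation a) ` \<U>)"
      using \<U>(1) by simp
    show "\<forall>U\<in>(-`) (rotation a) ` \<U>. open U \<and> closure U = UNIV"
      using \<U>(2) by (auto simp: open_vimage_rotation dense)
    show "\<Inter>((-`) (rotation a) ` \<U>) \<subseteq> rotation a -` G"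
      using \<U>(3) by auto
  qed
qed

text \<open>The Baire category theorem is applied on the real line, to the preimages of the dense
  open sets under the quotient map. These are dense because that map is open.\<close>

lemma residual_circle_nonempty:
  fixes G :: "circle set"
  assumes "residual G"
  shows "G \<noteq> {}"
proof -
  obtain \<U> where \<U>: "countable \<U>" "\<forall>U\<in>\<U>. open U \<and> closure U = UNIV" "\<Inter>\<U> \<subseteq> G"
    using assms unfolding residual_def by blast
  let ?\<V> = "(-`) abs_circle ` \<U>"
  have "UNIV \<subseteq> closure (\<Inter>?\<V>)"
  proof (rule Baire)
    show "countable ?\<V>"
      using \<U>(1) by simp
    fix T assume "T \<in> ?\<V>"
    then obtain U where U: "U \<in> \<U>" "T = abs_circle -` U"
      by blast
    have "x \<in> closure T" for x
      unfolding closure_iff_nhds_not_empty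
    proof (intro allI impI)
      fix A V assume "V \<subseteq> A" "open V" "x \<in> V"
      then have "abs_circle ` V \<inter> U \<noteq> {}"
        using \<U>(2) U(1) open_abs_circle_image[of V]
        by (metis empty_iff image_eqI inf_top.right_neutral open_Int_closure_eq_empty)
      then show "T \<inter> A \<noteq> {}"
        using \<open>V \<subseteq> A\<close> U(2) by blast
    qed
    then show "openin (top_of_set UNIV) T \<and> UNIV \<subseteq> closure T"
      using \<U>(2) U by (auto simp: open_circle_def)
  qed simp
  then have "\<Inter>?\<V> \<noteq> {}"
    by auto
  then obtain t where "t \<in> \<Inter>?\<V>"
    by blast
  then have "abs_circle t \<in> G"
    using \<U>(3) by blast
  then show ?thesis
    by blast
qed

text \<open>The discontinuities of a lower semicontinuous function lie on the frontiers of its sublevel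
  sets at rational heights.\<close>
lemma residual_isCont_lsc:
  fixes g :: "'a::t2_space \<Rightarrow> real"
  assumes "\<And>c. closed {x. g x \<le> c}"
  shows "residual {x. isCont g x}"
proof -
  let ?A = "\<lambda>q::real. {x. g x \<le> q}"
  have "residual (\<Inter>q\<in>\<rat>. - frontier (?A q))"
  proof (rule residual_INT)
    show "countable (\<rat> :: real set)"
      by (rule countable_rat)
    fix q :: real
    have "- frontier (?A q) = interior (?A q) \<union> - ?A q"
      using assms[of q] by (auto simp: frontier_def)
    then have "closure (- frontier (?A q)) = UNIV"
      using closure_subset[of "interior (?A q)"] by (auto simp: closure_complement)
    moreover have "open (- frontier (?A q))"
      by (rule open_Compl) (rule frontier_closed)
    ultimately show "residual (- frontier (?A q))"
      unfolding residual_def by (intro exI[of _ "{- frontier (?A q)}"]) auto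
  qed
  then show ?thesis
  proof (rule residual_mono, intro subsetI CollectI)
    fix x assume x: "x \<in> (\<Inter>q\<in>\<rat>. - frontier (?A q))"
    show "isCont g x"
      unfolding continuous_at
    proof (rule order_tendstoI)
      fix c assume "c < g x"
      then have "open (- ?A c)" "x \<in> - ?A c"
        using assms by auto
      then show "\<forall>\<^sub>F y in at x. c < g y"
        unfolding eventually_at_topological by (intro exI[of _ "- ?A c"]) auto
    next
      fix c assume "g x < c"
      then obtain q where q: "q \<in> \<rat>" "g x < q" "q < c"
        using Rats_dense_in_real by blast
      \<comment> \<open>\<open>x\<close> lies in the sublevel set at height \<open>q\<close> but off
        its frontier.\<close>
      then have "x \<in> interior (?A q)"
        using x assms[of q] by (auto simp: frontier_def)
      then show "\<forall>\<^sub>F y in at x. g y < c"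
        unfolding eventually_at_topological using q(3) interior_subset[of "?A q"]
        by (intro exI[of _ "interior (?A q)"]) auto
    qed
  qed
qed

section \<open>Fibres of strips\<close>

lemma closed_Omega: "closed Omega"
  unfolding Omega_def by (intro closed_Times) auto

lemma compact_Omega: "compact Omega"
  unfolding Omega_def by (intro compact_Times compact_UNIV_circle compact_Icc)

lemma strip_subset_Omega: "strip L \<Longrightarrow> L \<subseteq> Omega"
  and strip_closed: "strip L \<Longrightarrow> closed L"
  and strip_proj: "strip L \<Longrightarrow> fst ` L = UNIV"
  by (auto simp: strip_def)

lemma compact_strip:
  assumes "strip L"
  shows "compact L"
proof -
  have "compact (Omega \<inter> L)"
    using compact_Omega strip_closed[OF assms] by (rule compact_Int_closed)
  then show ?thesis
    using strip_subset_Omega[OF assms] by (simp add: Int_absorb1)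
qed

text \<open>Every fibre of a strip, generic or not, is compact and nonempty, so \<open>LEAST\<close>
  and \<open>GREATEST\<close> are attained and \<open>lower\<close> and \<open>upper\<close> are
  genuine extrema everywhere.\<close>

lemma strip_fibre:
  assumes "strip L"
  shows "(\<theta>, lower L \<theta>) \<in> L" "(\<theta>, upper L \<theta>) \<in> L"
    and "(\<theta>, x) \<in> L \<Longrightarrow> lower L \<theta> \<le> x" "(\<theta>, x) \<in> L \<Longrightarrow> x \<le> upper L \<theta>"
    and "0 \<le> lower L \<theta>" "lower L \<theta> \<le> upper L \<theta>" "upper L \<theta> \<le> 1"
proof -
  let ?S = "Pair \<theta> -` L"
  have "closed ?S"
    by (intro closed_vimage strip_closed[OF assms] continuous_intros)
  moreover have sub: "?S \<subseteq> {0..1}"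
    using strip_subset_Omega[OF assms] by (auto simp: Omega_def)
  ultimately have "compact ?S"
    by (metis compact_Icc compact_Int_closed inf.absorb_iff2)
  moreover have "\<theta> \<in> fst ` L"
    using strip_proj[OF assms] by simp
  then have "?S \<noteq> {}"
    by force
  ultimately obtain a b where a: "a \<in> ?S" "\<And>x. x \<in> ?S \<Longrightarrow> a \<le> x"
    and b: "b \<in> ?S" "\<And>x. x \<in> ?S \<Longrightarrow> x \<le> b"
    using compact_attains_inf[of ?S] compact_attains_sup[of ?S] by blast
  have ab: "lower L \<theta> = a" "upper L \<theta> = b"
    unfolding lower_def upper_def using a b by (auto intro!: Least_equality Greatest_equality)
  show "(\<theta>, lower L \<theta>) \<in> L" "(\<theta>, upper L \<theta>) \<in> L"
    and "(\<theta>, x) \<in> L \<Longrightarrow> lower L \<theta> \<le> x" "(\<theta>, x) \<in> L \<Longrightarrow> x \<le> upper L \<theta>"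
    and "0 \<le> lower L \<theta>" "lower L \<theta> \<le> upper L \<theta>" "upper L \<theta> \<le> 1"
    using a b sub by (auto simp: ab)
qed

text \<open>A sublevel set of \<open>lower L\<close> is the projection of a compact part of
  \<open>L\<close>, which makes the function lower semicontinuous.\<close>

lemma residual_isCont_lower:
  assumes "strip L"
  shows "residual {\<theta>. isCont (lower L) \<theta>}"
proof (rule residual_isCont_lsc)
  fix c :: real
  have "{\<theta>. lower L \<theta> \<le> c} = fst ` (L \<inter> UNIV \<times> {..c})"
    proof (intro equalityI subsetI)
      fix \<theta> assume "\<theta> \<in> {\<theta>. lower L \<theta> \<le> c}"
      then show "\<theta> \<in> fst ` (L \<inter> UNIV \<times> {..c})"
        using strip_fibre(1)[OF assms, of \<theta>] by (intro image_eqI[of _ _ "(\<theta>, lower L \<theta>)"]) auto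
    next
      fix \<theta> assume "\<theta> \<in> fst ` (L \<inter> UNIV \<times> {..c})"
      then obtain x where x: "(\<theta>, x) \<in> L" "x \<in> {..c}"
        by auto
      then show "\<theta> \<in> {\<theta>. lower L \<theta> \<le> c}"
        using strip_fibre(3,4)[OF assms x(1)] by auto
    qed
  moreover have "compact (L \<inter> UNIV \<times> {..c})"
    by (intro compact_Int_closed compact_strip assms closed_Times) auto
  then have "compact (fst ` (L \<inter> UNIV \<times> {..c}))"
    by (intro compact_continuous_image continuous_intros)
  ultimately show "closed {\<theta>. lower L \<theta> \<le> c}"
    by (simp add: compact_imp_closed)
qed

lemma residual_isCont_upper:
  assumes "strip L"
  shows "residual {\<theta>. isCont (upper L) \<theta>}"
proof -
  have "residual {\<theta>. isCont (\<lambda>\<theta>. - upper L \<theta>) \<theta>}"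
  proof (rule residual_isCont_lsc)
    fix c :: real
    have "{\<theta>. - upper L \<theta> \<le> c} = fst ` (L \<inter> UNIV \<times> {-c..})"
      proof (intro equalityI subsetI)
        fix \<theta> assume "\<theta> \<in> {\<theta>. - upper L \<theta> \<le> c}"
        then show "\<theta> \<in> fst ` (L \<inter> UNIV \<times> {-c..})"
          using strip_fibre(2)[OF assms, of \<theta>] by (intro image_eqI[of _ _ "(\<theta>, upper L \<theta>)"]) auto
      next
        fix \<theta> assume "\<theta> \<in> fst ` (L \<inter> UNIV \<times> {-c..})"
        then obtain x where x: "(\<theta>, x) \<in> L" "x \<in> {-c..}"
          by auto
        then show "\<theta> \<in> {\<theta>. - upper L \<theta> \<le> c}"
          using strip_fibre(3,4)[OF assms x(1)] by auto
      qed
    moreover have "compact (L \<inter> UNIV \<times> {-c..})"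
      by (intro compact_Int_closed compact_strip assms closed_Times) auto
    then have "compact (fst ` (L \<inter> UNIV \<times> {-c..}))"
      by (intro compact_continuous_image continuous_intros)
    ultimately show "closed {\<theta>. - upper L \<theta> \<le> c}"
      by (simp add: compact_imp_closed)
  qed
  moreover have "isCont (upper L) \<theta>" if "isCont (\<lambda>\<theta>. - upper L \<theta>) \<theta>" for \<theta>
    using continuous_minus[OF that] by simp
  then have "{\<theta>. isCont (\<lambda>\<theta>. - upper L \<theta>) \<theta>} \<subseteq> {\<theta>. isCont (upper L) \<theta>}"
    by blast
  ultimately show ?thesis
    by (rule residual_mono)
qed

text \<open>Near a continuity point the graph stays close to the height \<open>g \<theta>\<close>,
  so taking the closure adds no other point over \<open>\<theta>\<close>. Hence top and bottom
  covers have one-point fibres over generic base points.\<close>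

lemma fibre_closure_graph:
  fixes g :: "'a::t2_space \<Rightarrow> 'b::t2_space"
  assumes "isCont g \<theta>"
  shows "(\<theta>, x) \<in> closure {(t, g t) | t. isCont g t} \<longleftrightarrow> x = g \<theta>"
proof
  assume cl: "(\<theta>, x) \<in> closure {(t, g t) | t. isCont g t}"
  show "x = g \<theta>"
  proof (rule ccontr)
    assume "x \<noteq> g \<theta>"
    then obtain U V where UV: "open U" "open V" "x \<in> U" "g \<theta> \<in> V" "U \<inter> V = {}"
      by (meson hausdorff)
    obtain A where A: "open A" "\<theta> \<in> A" "\<forall>t\<in>A. g t \<in> V"
      using assms UV(2,4) unfolding continuous_at_open by blast
    have "open (A \<times> U)" "(\<theta>, x) \<in> A \<times> U"
      using A UV by (auto intro: open_Times)
    with cl have "{(t, g t) | t. isCont g t} \<inter> A \<times> U \<noteq> {}"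
      unfolding closure_iff_nhds_not_empty by blast
    then show False
      using A(3) UV(5) by auto
  qed
next
  assume "x = g \<theta>"
  with assms have "(\<theta>, x) \<in> {(t, g t) | t. isCont g t}"
    by blast
  then show "(\<theta>, x) \<in> closure {(t, g t) | t. isCont g t}"
    by (rule subsetD[OF closure_subset])
qed

lemma upper_lower_singleton_fibre:
  assumes "\<And>x. (\<theta>, x) \<in> A \<longleftrightarrow> x = c"
  shows "upper A \<theta> = c" "lower A \<theta> = c"
  unfolding upper_def lower_def assms by (auto intro: Greatest_equality Least_equality)

lemma bottom_cover_fibre:
  assumes "isCont (lower L) \<theta>"
  shows "(\<theta>, x) \<in> bottom_cover L \<longleftrightarrow> x = lower L \<theta>"
  using fibre_closure_graph[OF assms] by (simp add: bottom_cover_def)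

lemma top_cover_fibre:
  assumes "isCont (upper L) \<theta>"
  shows "(\<theta>, x) \<in> top_cover L \<longleftrightarrow> x = upper L \<theta>"
  using fibre_closure_graph[OF assms] by (simp add: top_cover_def)

lemma cover_subset_Omega:
  assumes "strip L"
  shows "bottom_cover L \<subseteq> Omega" "top_cover L \<subseteq> Omega"
proof -
  have "{(\<theta>, lower L \<theta>) | \<theta>. isCont (lower L) \<theta>} \<subseteq> Omega"
    "{(\<theta>, upper L \<theta>) | \<theta>. isCont (upper L) \<theta>} \<subseteq> Omega"
    using strip_fibre(1,2)[OF assms] strip_subset_Omega[OF assms] by blast+
  then show "bottom_cover L \<subseteq> Omega" "top_cover L \<subseteq> Omega"
    unfolding bottom_cover_def top_cover_def by (simp_all add: closure_minimal closed_Omega)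
qed

text \<open>A relatively interior point of \<open>L\<close> has a box around it whose part in
  \<open>Omega\<close> lies in \<open>L\<close>; two heights in that box bound all fibres over its
  base from below.\<close>

lemma strip_interior_fibres:
  assumes "strip L" "top_of_set Omega interior_of L \<noteq> {}"
  obtains V c where "open V" "V \<noteq> {}" "c > 0" "\<And>\<theta>. \<theta> \<in> V \<Longrightarrow> c \<le> upper L \<theta> - lower L \<theta>"
proof -
  obtain T \<theta> x where T: "openin (top_of_set Omega) T" "T \<subseteq> L" "(\<theta>, x) \<in> T"
    using assms(2) unfolding interior_of_def by auto
  then obtain W where W: "open W" "T = Omega \<inter> W"
    by (auto simp: openin_open)
  with T(3) obtain V B where VB: "open V" "open B" "\<theta> \<in> V" "x \<in> B" "V \<times> B \<subseteq> W"
    using open_prod_elim[of W "(\<theta>, x)"] by (metis Int_iff mem_Sigma_iff)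
  have x: "0 \<le> x" "x \<le> 1"
    using T(3) W(2) by (auto simp: Omega_def)
  obtain e where e: "e > 0" "ball x e \<subseteq> B"
    using VB(2,4) by (meson openE)
  \<comment> \<open>The step goes from \<open>x\<close> towards the farther end of the unit
    interval; with \<open>d \<le> 1 / 2\<close> it cannot leave it, and with \<open>d < e\<close> it
    stays in the box.\<close>
  define d where "d = min (e / 2) (1 / 2)"
  define y where "y = (if x \<le> 1 / 2 then x + d else x - d)"
  have d: "0 < d" "d < e" "d \<le> 1 / 2"
    using e(1) by (auto simp: d_def)
  have y: "0 \<le> y" "y \<le> 1" "\<bar>x - y\<bar> = d"
    using x d by (auto simp: y_def)
  then have "y \<in> B"
    using e d by (auto simp: dist_real_def)
  have "d \<le> upper L \<phi> - lower L \<phi>" if "\<phi> \<in> V" for \<phi>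
  proof -
    have "(\<phi>, x) \<in> L" "(\<phi>, y) \<in> L"
      using that VB(4,5) \<open>y \<in> B\<close> x y T(2) W(2) by (auto simp: Omega_def)
    then show ?thesis
      using strip_fibre(3,4)[OF assms(1), of \<phi> x] strip_fibre(3,4)[OF assms(1), of \<phi> y] y(3)
      by linarith
  qed
  then show thesis
    using that[of V d] VB(1,3) d(1) by blast
qed

section \<open>Horseshoes of interval maps\<close>

text \<open>\<open>b\<close> is the leftmost point of \<open>{p..q}\<close> at level
  \<open>g q\<close>, and \<open>a\<close> the rightmost point of \<open>{p..b}\<close> at level
  \<open>g p\<close>. Strictly between them neither level is attained again, so by the intermediate
  value theorem the values stay strictly between the two levels.\<close>

lemma tight_increasing_subinterval:
  fixes g :: "real \<Rightarrow> real"
  assumes "p < q" and cont: "continuous_on {p..q} g" and "g p < g q"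
  shows "\<exists>a b. p \<le> a \<and> a < b \<and> b \<le> q \<and> {g p..g q} \<subseteq> g ` {a..b} \<and>
    g ` {a<..<b} \<subseteq> {g p<..<g q}"
proof -
  have level: "compact ({x..y} \<inter> g -` {c})" if "p \<le> x" "y \<le> q" for x y c
  proof -
    have "continuous_on {x..y} g"
      using that by (intro continuous_on_subset[OF cont]) auto
    then have "closed ({x..y} \<inter> g -` {c})"
      by (simp add: continuous_closed_preimage)
    then show ?thesis
      by (metis compact_Icc compact_Int_closed inf.left_idem)
  qed
  have "q \<in> {p..q} \<inter> g -` {g q}"
    using \<open>p < q\<close> by simp
  then obtain b where b: "b \<in> {p..q} \<inter> g -` {g q}" "\<And>x. x \<in> {p..q} \<inter> g -` {g q} \<Longrightarrow> b \<le> x"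
    using compact_attains_inf[OF level[of p q "g q"]] by blast
  have "p \<in> {p..b} \<inter> g -` {g p}"
    using b(1) by simp
  then obtain a where a: "a \<in> {p..b} \<inter> g -` {g p}" "\<And>x. x \<in> {p..b} \<inter> g -` {g p} \<Longrightarrow> x \<le> a"
    using compact_attains_sup[OF level[of p b "g p"]] b(1) by (metis Int_iff atLeastAtMost_iff empty_iff order_refl)
  have ab: "p \<le> a" "a < b" "b \<le> q" "g a = g p" "g b = g q"
    using a(1) b(1) \<open>g p < g q\<close> by (auto simp: order_less_le)
  have ivt: "\<exists>x. y \<le> x \<and> x \<le> z \<and> g x = c" if "p \<le> y" "y \<le> z" "z \<le> q" "g y \<le> c" "c \<le> g z" for y z c
    using that by (intro IVT' continuous_on_subset[OF cont]) auto
  have "{g p..g q} \<subseteq> g ` {a..b}"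
  proof
    fix c assume "c \<in> {g p..g q}"
    then obtain x where "a \<le> x" "x \<le> b" "g x = c"
      using ivt[of a b c] ab by auto
    then show "c \<in> g ` {a..b}"
      by force
  qed
  moreover have "g ` {a<..<b} \<subseteq> {g p<..<g q}"
  proof (intro image_subsetI)
    fix x assume x: "x \<in> {a<..<b}"
    have "g x < g q"
    proof (rule ccontr)
      assume "\<not> g x < g q"
      then obtain y where "a \<le> y" "y \<le> x" "g y = g q"
        using ivt[of a x "g q"] x ab \<open>g p < g q\<close> by auto
      then show False
        using b(2)[of y] x ab by auto
    qed
    moreover have "g p < g x"
    proof (rule ccontr)
      assume "\<not> g p < g x"
      then obtain y where "x \<le> y" "y \<le> b" "g y = g p"
        using ivt[of x b "g p"] x ab \<open>g p < g q\<close> by auto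
      then show False
        using a(2)[of y] x ab by auto
    qed
    ultimately show "g x \<in> {g p<..<g q}"
      by simp
  qed
  ultimately show ?thesis
    using ab by blast
qed

text \<open>The point is the last inclusion: pieces that cover different target intervals get
  disjoint interiors, which plain covering would not give. If the preimages of \<open>c\<close> and
  \<open>d\<close> come in reverse order, \<open>g\<close> is replaced by its negative.\<close>

lemma tight_subinterval:
  fixes g :: "real \<Rightarrow> real"
  assumes cont: "continuous_on {a..b} g" and "c < d" and "{c..d} \<subseteq> g ` {a..b}"
  shows "\<exists>a' b'. a \<le> a' \<and> a' < b' \<and> b' \<le> b \<and> {c..d} \<subseteq> g ` {a'..b'} \<and>
    g ` {a'<..<b'} \<subseteq> {c<..<d}"
proof -
  have "c \<in> g ` {a..b}" "d \<in> g ` {a..b}"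
    using assms(2,3) by auto
  then obtain p q where p: "p \<in> {a..b}" "c = g p" and q: "q \<in> {a..b}" "d = g q"
    by blast
  consider "p < q" | "q < p"
    using p(2) q(2) \<open>c < d\<close> by fastforce
  then show ?thesis
  proof cases
    case 1
    have "continuous_on {p..q} g"
      using p q by (intro continuous_on_subset[OF cont]) auto
    from tight_increasing_subinterval[OF 1 this] obtain a' b' where
      "p \<le> a' \<and> a' < b' \<and> b' \<le> q \<and> {c..d} \<subseteq> g ` {a'..b'} \<and> g ` {a'<..<b'} \<subseteq> {c<..<d}"
      using p(2) q(2) \<open>c < d\<close> by auto
    then show ?thesis
      using p(1) q(1) by (intro exI[of _ a'] exI[of _ b']) auto
  next
    case 2
    have "continuous_on {q..p} (\<lambda>x. - g x)"
      using p q by (intro continuous_on_minus continuous_on_subset[OF cont]) auto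
    from tight_increasing_subinterval[OF 2 this] obtain a' b' where
      *: "q \<le> a'" "a' < b'" "b' \<le> p" "{- d..- c} \<subseteq> (\<lambda>x. - g x) ` {a'..b'}"
      "(\<lambda>x. - g x) ` {a'<..<b'} \<subseteq> {- d<..<- c}"
      using p(2) q(2) \<open>c < d\<close> by auto
    have "{c..d} \<subseteq> g ` {a'..b'}"
    proof
      fix y assume "y \<in> {c..d}"
      then have "- y \<in> {- d..- c}"
        by simp
      with *(4) have "- y \<in> (\<lambda>x. - g x) ` {a'..b'}"
        by blast
      then show "y \<in> g ` {a'..b'}"
        by auto
    qed
    moreover have "g ` {a'<..<b'} \<subseteq> {c<..<d}"
      using *(5) by (auto simp: image_subset_iff)
    ultimately show ?thesis
      using p(1) q(1) * by (intro exI[of _ a'] exI[of _ b']) auto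
  qed
qed

text \<open>A pair \<open>c\<close> stands for the interval from \<open>fst c\<close> to \<open>snd c\<close>.\<close>
definition interval_horseshoe ::
    "(real \<Rightarrow> real) \<Rightarrow> real set \<Rightarrow> real set \<Rightarrow> (real \<times> real) set \<Rightarrow> bool"
  where "interval_horseshoe g X Y C \<longleftrightarrow>
    finite C \<and> (\<forall>c\<in>C. fst c < snd c \<and> {fst c..snd c} \<subseteq> X \<and> Y \<subseteq> g ` {fst c..snd c}) \<and>
    pairwise (\<lambda>c d. disjnt {fst c<..<snd c} {fst d<..<snd d}) C"

lemma interval_horseshoe_cong:
  assumes "\<And>x. x \<in> X \<Longrightarrow> g x = h x" "interval_horseshoe g X Y C"
  shows "interval_horseshoe h X Y C"
proof -
  have "g ` {fst c..snd c} = h ` {fst c..snd c}" if "c \<in> C" for c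
  proof (intro image_cong refl assms(1))
    have "{fst c..snd c} \<subseteq> X"
      using assms(2) that by (simp add: interval_horseshoe_def)
    then show "x \<in> X" if "x \<in> {fst c..snd c}" for x
      using that by (rule subsetD)
  qed
  then show ?thesis
    using assms(2) by (simp add: interval_horseshoe_def)
qed

text \<open>For each \<open>c\<close> in \<open>C\<close> and \<open>d\<close> in \<open>D\<close>
  there is a tight piece of \<open>c\<close> that \<open>g\<close> maps over \<open>d\<close>.
  Pieces from different \<open>c\<close> are disjoint because they lie in \<open>c\<close>; pieces
  for different \<open>d\<close> are disjoint because \<open>g\<close> sends their interiors into
  the interiors of the \<open>d\<close>.\<close>

lemma interval_horseshoe_compose:
  assumes C: "interval_horseshoe g X Y C" and D: "interval_horseshoe h Y Z D"
    and cont: "continuous_on X g"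
  shows "\<exists>E. interval_horseshoe (h \<circ> g) X Z E \<and> card E = card C * card D"
proof -
  define P where "P c d e \<longleftrightarrow> fst c \<le> fst e \<and> fst e < snd e \<and> snd e \<le> snd c \<and>
      {fst d..snd d} \<subseteq> g ` {fst e..snd e} \<and> g ` {fst e<..<snd e} \<subseteq> {fst d<..<snd d}"
    for c d e :: "real \<times> real"
  define e where "e c d = (SOME e. P c d e)" for c d
  have e_P: "P c d (e c d)" if "c \<in> C" "d \<in> D" for c d
  proof -
    have c: "{fst c..snd c} \<subseteq> X" "Y \<subseteq> g ` {fst c..snd c}"
      using \<open>c \<in> C\<close> C unfolding interval_horseshoe_def by blast+
    have d: "fst d < snd d" "{fst d..snd d} \<subseteq> Y"
      using \<open>d \<in> D\<close> D unfolding interval_horseshoe_def by blast+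
    obtain a b where "fst c \<le> a \<and> a < b \<and> b \<le> snd c \<and>
        {fst d..snd d} \<subseteq> g ` {a..b} \<and> g ` {a<..<b} \<subseteq> {fst d<..<snd d}"
      using tight_subinterval[OF continuous_on_subset[OF cont c(1)] d(1) order_trans[OF d(2) c(2)]]
      by blast
    then have "P c d (a, b)"
      by (simp add: P_def)
    then show ?thesis
      unfolding e_def by (rule someI)
  qed
  note e = e_P[unfolded P_def]
  let ?I = "\<lambda>c. {fst c<..<snd c :: real}"
  let ?e = "\<lambda>x. e (fst x) (snd x)"
  have disj: "disjnt (?I (?e x)) (?I (?e y))" if "x \<in> C \<times> D" "y \<in> C \<times> D" "x \<noteq> y" for x y
  proof -
    obtain c d c' d' where xy: "x = (c, d)" "y = (c', d')" "c \<in> C" "d \<in> D" "c' \<in> C" "d' \<in> D"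
      using \<open>x \<in> C \<times> D\<close> \<open>y \<in> C \<times> D\<close> by blast
    note ex = e[OF xy(3,4)] and ey = e[OF xy(5,6)]
    consider "c \<noteq> c'" | "d \<noteq> d'"
      using \<open>x \<noteq> y\<close> xy(1,2) by blast
    then show ?thesis
    proof cases
      case 1
      then have "disjnt (?I c) (?I c')"
        using C xy by (auto simp: interval_horseshoe_def pairwise_def)
      moreover have "?I (e c d) \<subseteq> ?I c" "?I (e c' d') \<subseteq> ?I c'"
        using ex ey by auto
      ultimately show ?thesis
        unfolding xy fst_conv snd_conv disjnt_def by blast
    next
      case 2
      then have "disjnt (?I d) (?I d')"
        using D xy by (auto simp: interval_horseshoe_def pairwise_def)
      moreover have "g ` ?I (e c d) \<subseteq> ?I d" "g ` ?I (e c' d') \<subseteq> ?I d'"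
        using ex ey by auto
      ultimately show ?thesis
        unfolding xy fst_conv snd_conv disjnt_def by blast
    qed
  qed
  \<comment> \<open>Equal pieces for different pairs would be disjoint from themselves, but their
    interiors are nonempty. Thus no itinerary is lost in the count.\<close>
  have "inj_on ?e (C \<times> D)"
  proof (rule inj_onI, rule ccontr)
    fix x y assume xy: "x \<in> C \<times> D" "y \<in> C \<times> D" "?e x = ?e y" "x \<noteq> y"
    then have "?I (?e x) = {}"
      using disj[of x y] by (simp add: disjnt_def)
    moreover have "fst (?e x) < snd (?e x)"
      using e xy(1) by auto
    ultimately show False
      by (metis greaterThanLessThan_empty_iff not_less)
  qed
  then have "card (?e ` (C \<times> D)) = card C * card D"
    by (simp add: card_image card_cartesian_product)
  moreover have "interval_horseshoe (h \<circ> g) X Z (?e ` (C \<times> D))"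
    unfolding interval_horseshoe_def
  proof (intro conjI ballI)
    show "finite (?e ` (C \<times> D))"
      using C D by (simp add: interval_horseshoe_def)
    show "pairwise (\<lambda>c d. disjnt (?I c) (?I d)) (?e ` (C \<times> D))"
      unfolding pairwise_def using disj by blast
  next
    fix x assume "x \<in> ?e ` (C \<times> D)"
    then obtain c d where x: "x = e c d" "c \<in> C" "d \<in> D"
      by auto
    note ex = e[OF x(2,3), folded x(1)]
    show "fst x < snd x"
      using ex by simp
    have "{fst x..snd x} \<subseteq> {fst c..snd c}"
      using ex by auto
    moreover have "{fst c..snd c} \<subseteq> X"
      using C x(2) by (simp add: interval_horseshoe_def)
    ultimately show "{fst x..snd x} \<subseteq> X"
      by (rule order_trans)
    have "Z \<subseteq> h ` {fst d..snd d}"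
      using D x(3) by (simp add: interval_horseshoe_def)
    also have "\<dots> \<subseteq> h ` g ` {fst x..snd x}"
      using ex by (intro image_mono) simp
    finally show "Z \<subseteq> (h \<circ> g) ` {fst x..snd x}"
      by (simp add: image_comp)
  qed
  ultimately show ?thesis
    by blast
qed

lemma disjnt_greaterThanLessThan:
  fixes a b c d :: real
  assumes "disjnt {a<..<b} {c<..<d}" "a < b" "c < d" "a \<le> c"
  shows "b \<le> c"
proof (rule ccontr)
  assume "\<not> b \<le> c"
  \<comment> \<open>The midpoint of the overlap.\<close>
  then have "(c + min b d) / 2 \<in> {a<..<b} \<inter> {c<..<d}"
    using assms(3,4) by (auto simp: min_def)
  then show False
    using assms(1) by (auto simp: disjnt_def)
qed

text \<open>Dropping every other interval leaves gaps as long as the dropped intervals.\<close>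
lemma separated_half:
  fixes C :: "(real \<times> real) set"
  assumes "finite C" "\<eta> > 0" "\<And>c. c \<in> C \<Longrightarrow> fst c + \<eta> \<le> snd c"
    and "pairwise (\<lambda>c d. disjnt {fst c<..<snd c} {fst d<..<snd d}) C"
  shows "\<exists>E\<subseteq>C. card C \<le> 2 * card E \<and>
    pairwise (\<lambda>c d. snd c + \<eta> \<le> fst d \<or> snd d + \<eta> \<le> fst c) E"
  using assms
proof (induction "card C" arbitrary: C rule: less_induct)
  case less
  have last: "\<exists>d\<in>A. \<forall>c\<in>A. c \<noteq> d \<longrightarrow> snd c \<le> fst d" if "A \<subseteq> C" "A \<noteq> {}" for A
  proof -
    have "finite A"
      using that(1) less.prems(1) by (rule finite_subset)
    then have "Max (fst ` A) \<in> fst ` A"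
      using \<open>A \<noteq> {}\<close> by (intro Max_in) auto
    then obtain d where d: "d \<in> A" "fst d = Max (fst ` A)"
      by force
    then have d_max: "fst c \<le> fst d" if "c \<in> A" for c
      using \<open>finite A\<close> that by simp
    have "snd c \<le> fst d" if "c \<in> A" "c \<noteq> d" for c
    proof (rule disjnt_greaterThanLessThan)
      show "disjnt {fst c<..<snd c} {fst d<..<snd d}"
        using less.prems(4) that d(1) \<open>A \<subseteq> C\<close> by (auto simp: pairwise_def)
      show "fst c < snd c" "fst d < snd d"
        using less.prems(2) less.prems(3)[of c] less.prems(3)[of d] that d(1) \<open>A \<subseteq> C\<close> by auto
    qed (use d_max that in auto)
    with d(1) show ?thesis
      by blast
  qed
  show ?case
  proof (cases "C = {}")
    case True
    then show ?thesis
      by (intro exI[of _ "{}"]) simp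
  next
    case False
    from last[OF subset_refl this] obtain d where d: "d \<in> C" "\<And>c. c \<in> C \<Longrightarrow> c \<noteq> d \<Longrightarrow> snd c \<le> fst d"
      by blast
    show ?thesis
    proof (cases "C = {d}")
      case True
      then show ?thesis
        by (intro exI[of _ "{d}"]) simp
    next
      case False
      then have "C - {d} \<noteq> {}" "C - {d} \<subseteq> C"
        using d(1) by auto
      from last[OF this(2,1)] obtain e where
        "e \<in> C - {d}" "\<forall>c\<in>C - {d}. c \<noteq> e \<longrightarrow> snd c \<le> fst e"
        by blast
      then have e: "e \<in> C" "e \<noteq> d" "\<And>c. c \<in> C \<Longrightarrow> c \<noteq> d \<Longrightarrow> c \<noteq> e \<Longrightarrow> snd c \<le> fst e"
        by auto
      \<comment> \<open>The rightmost interval \<open>d\<close> is kept and its left neighbour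
        \<open>e\<close> is dropped. Everything in \<open>B\<close> ends before \<open>e\<close>
        begins, so the length of \<open>e\<close> supplies the gap to \<open>d\<close>; two
        intervals are removed for one that is kept.\<close>
      define B where "B = C - {d} - {e}"
      have card: "card C = Suc (Suc (card B))" "finite B"
        using card_Suc_Diff1[of C d] card_Suc_Diff1[of "C - {d}" e] less.prems(1) d(1) e(1,2)
        by (simp_all add: B_def)
      have "\<exists>E\<subseteq>B. card B \<le> 2 * card E \<and>
          pairwise (\<lambda>c d. snd c + \<eta> \<le> fst d \<or> snd d + \<eta> \<le> fst c) E"
      proof (rule less.hyps)
        show "pairwise (\<lambda>c d. disjnt {fst c<..<snd c} {fst d<..<snd d}) B"
          using less.prems(4) by (rule pairwise_subset) (auto simp: B_def)
      qed (use card less.prems(2,3) in \<open>auto simp: B_def\<close>)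
      then obtain E where E: "E \<subseteq> B" "card B \<le> 2 * card E"
          "pairwise (\<lambda>c d. snd c + \<eta> \<le> fst d \<or> snd d + \<eta> \<le> fst c) E"
        by blast
      have gap: "snd c + \<eta> \<le> fst d" if "c \<in> E" for c
      proof -
        have "snd c \<le> fst e"
          using e(3)[of c] E(1) that unfolding B_def by blast
        then show ?thesis
          using d(2)[OF e(1,2)] less.prems(3)[OF e(1)] by linarith
      qed
      have "d \<notin> E" "finite E"
        using E(1) card(2) by (auto simp: B_def intro: finite_subset)
      show ?thesis
      proof (intro exI[of _ "insert d E"] conjI)
        show "insert d E \<subseteq> C"
          using E(1) d(1) by (auto simp: B_def)
        show "card C \<le> 2 * card (insert d E)"
          using \<open>d \<notin> E\<close> \<open>finite E\<close> E(2) card(1) by simp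
        show "pairwise (\<lambda>c d. snd c + \<eta> \<le> fst d \<or> snd d + \<eta> \<le> fst c) (insert d E)"
          using E(3) gap by (auto simp: pairwise_insert)
      qed
    qed
  qed
qed

text \<open>The image of each interval contains both \<open>u\<close> and \<open>v\<close>, which
  are \<open>\<delta>\<close> apart, so the modulus of continuity forces the interval to have length
  at least \<open>\<eta>\<close>.\<close>

lemma interval_horseshoe_separated_half:
  assumes C: "interval_horseshoe g X Y C" and "\<eta> > 0"
    and modulus: "\<And>x y. x \<in> X \<Longrightarrow> y \<in> X \<Longrightarrow> \<bar>x - y\<bar> < \<eta> \<Longrightarrow> \<bar>g x - g y\<bar> < \<delta>"
    and uv: "u \<in> Y" "v \<in> Y" "\<delta> \<le> \<bar>u - v\<bar>"
  shows "\<exists>E\<subseteq>C. card C \<le> 2 * card E \<and>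
    pairwise (\<lambda>c d. snd c + \<eta> \<le> fst d \<or> snd d + \<eta> \<le> fst c) E"
proof (rule separated_half)
  show "finite C" "pairwise (\<lambda>c d. disjnt {fst c<..<snd c} {fst d<..<snd d}) C"
    using C by (auto simp: interval_horseshoe_def)
  show "fst c + \<eta> \<le> snd c" if "c \<in> C" for c
  proof -
    have c: "{fst c..snd c} \<subseteq> X" "Y \<subseteq> g ` {fst c..snd c}"
      using C that by (auto simp: interval_horseshoe_def)
    then obtain x y where xy: "x \<in> {fst c..snd c}" "y \<in> {fst c..snd c}" "u = g x" "v = g y"
      using uv by blast
    then have "x \<in> X" "y \<in> X"
      using c(1) by blast+
    then have "\<not> \<bar>x - y\<bar> < \<eta>"
      using modulus[of x y] uv(3) xy(3,4) by auto
    then show ?thesis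
      using xy(1,2) by auto
  qed
qed fact

section \<open>Fibre maps of skew products\<close>

locale skew_product =
  fixes F :: "circle \<times> real \<Rightarrow> circle \<times> real" and \<omega> :: real and f :: "circle \<times> real \<Rightarrow> real"
  assumes irrational: "\<omega> \<notin> \<rat>"
    and continuous_f: "continuous_on Omega f"
    and f_range: "f ` Omega \<subseteq> {0..1}"
    and F_eq: "x \<in> {0..1} \<Longrightarrow> F (\<theta>, x) = (rotation \<omega> \<theta>, f (\<theta>, x))"
begin

definition fibre_map :: "nat \<Rightarrow> circle \<Rightarrow> real \<Rightarrow> real"
  where "fibre_map n \<theta> x = snd ((F ^^ n) (\<theta>, x))"

lemma iterate_F:
  assumes "x \<in> {0..1}"
  shows "(F ^^ n) (\<theta>, x) = (rotation (real n * \<omega>) \<theta>, fibre_map n \<theta> x) \<and> fibre_map n \<theta> x \<in> {0..1}"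
proof (induction n)
  case 0
  then show ?case
    using assms by (simp add: fibre_map_def)
next
  case (Suc n)
  then have F: "(F ^^ Suc n) (\<theta>, x) =
      (rotation \<omega> (rotation (real n * \<omega>) \<theta>), f (rotation (real n * \<omega>) \<theta>, fibre_map n \<theta> x))"
    by (simp add: F_eq)
  have "(rotation (real n * \<omega>) \<theta>, fibre_map n \<theta> x) \<in> Omega"
    using Suc by (simp add: Omega_def)
  then have "f (rotation (real n * \<omega>) \<theta>, fibre_map n \<theta> x) \<in> {0..1}"
    using f_range by blast
  moreover have "fibre_map (Suc n) \<theta> x = f (rotation (real n * \<omega>) \<theta>, fibre_map n \<theta> x)"
    unfolding fibre_map_def[of "Suc n"] F by simp
  ultimately show ?case
    unfolding F by (simp add: rotation_add algebra_simps)
qed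

lemma F_Omega: "p \<in> Omega \<Longrightarrow> F p \<in> Omega"
  using iterate_F[of "snd p" 1 "fst p"] by (auto simp: Omega_def)

lemma iterate_Omega: "p \<in> Omega \<Longrightarrow> (F ^^ n) p \<in> Omega"
  by (induction n) (simp_all add: F_Omega)

lemma fibre_map_0 [simp]: "fibre_map 0 \<theta> x = x"
  by (simp add: fibre_map_def)

lemma fibre_map_1: "x \<in> {0..1} \<Longrightarrow> fibre_map (Suc 0) \<theta> x = f (\<theta>, x)"
  by (simp add: fibre_map_def F_eq)

text \<open>The cocycle identity: after \<open>m\<close> steps the remaining map belongs to the
  rotated base point.\<close>

lemma fibre_map_add:
  assumes "x \<in> {0..1}"
  shows "fibre_map (m + n) \<theta> x = fibre_map n (rotation (real m * \<omega>) \<theta>) (fibre_map m \<theta> x)"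
  using iterate_F[OF assms, of m \<theta>] by (simp add: fibre_map_def funpow_add add.commute[of m])

lemma continuous_on_iterate: "continuous_on Omega (F ^^ n)"
proof -
  have "continuous_on UNIV (rotation \<omega>)"
    by (simp add: continuous_on_open_vimage open_vimage_rotation)
  from continuous_on_compose2[OF this continuous_on_fst[OF continuous_on_id]]
  have "continuous_on Omega (\<lambda>p. rotation \<omega> (fst p))"
    by blast
  then have "continuous_on Omega (\<lambda>p. (rotation \<omega> (fst p), f p))"
    using continuous_f by (rule continuous_on_Pair)
  moreover have "F p = (rotation \<omega> (fst p), f p)" if "p \<in> Omega" for p
    using that F_eq[of "snd p" "fst p"] by (auto simp: Omega_def)
  then have "continuous_on Omega F \<longleftrightarrow> continuous_on Omega (\<lambda>p. (rotation \<omega> (fst p), f p))"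
    by (intro continuous_on_cong refl)
  ultimately have F: "continuous_on Omega F"
    by blast
  show ?thesis
  proof (induction n)
    case (Suc n)
    have "(F ^^ n) ` Omega \<subseteq> Omega"
      using iterate_Omega by blast
    from continuous_on_compose[OF Suc continuous_on_subset[OF F this]] show ?case
      by simp
  qed (simp add: id_def continuous_on_id)
qed

lemma continuous_on_fibre_map: "continuous_on {0..1} (fibre_map n \<theta>)"
proof -
  have "continuous_on {0..1} (\<lambda>x. (F ^^ n) (\<theta>, x))"
    by (intro continuous_on_compose2[OF continuous_on_iterate] continuous_intros)
      (auto simp: Omega_def)
  then show ?thesis
    unfolding fibre_map_def by (rule continuous_on_snd)
qed

text \<open>Lifting the circle to the unit interval turns the iterate into a continuous map on a
  compact square, where uniform continuity gives one \<open>\<eta>\<close> for all base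
  points.\<close>

lemma fibre_map_modulus:
  assumes "\<epsilon> > 0"
  shows "\<exists>\<eta>>0. \<forall>\<theta>. \<forall>x\<in>{0..1}. \<forall>y\<in>{0..1}. \<bar>x - y\<bar> < \<eta> \<longrightarrow>
    \<bar>fibre_map n \<theta> x - fibre_map n \<theta> y\<bar> < \<epsilon>"
proof -
  let ?g = "\<lambda>p :: real \<times> real. snd ((F ^^ n) (abs_circle (fst p), snd p))"
  let ?S = "{0..1} \<times> {0..1} :: (real \<times> real) set"
  from continuous_on_compose2[OF continuous_on_abs_circle continuous_on_fst[OF continuous_on_id]]
  have "continuous_on ?S (\<lambda>p. abs_circle (fst p))"
    by blast
  then have "continuous_on ?S (\<lambda>p. (abs_circle (fst p), snd p))"
    by (intro continuous_on_Pair continuous_on_snd continuous_on_id)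
  moreover have "(\<lambda>p. (abs_circle (fst p), snd p)) ` ?S \<subseteq> Omega"
    by (auto simp: Omega_def)
  ultimately have "continuous_on ?S ?g"
    by (intro continuous_on_snd continuous_on_compose2[OF continuous_on_iterate])
  moreover have "compact ?S"
    by (intro compact_Times compact_Icc)
  ultimately have "uniformly_continuous_on ?S ?g"
    by (rule compact_uniformly_continuous)
  then obtain \<eta> where \<eta>: "\<eta> > 0" "\<And>p p'. p \<in> ?S \<Longrightarrow> p' \<in> ?S \<Longrightarrow> dist p' p < \<eta> \<Longrightarrow> dist (?g p') (?g p) < \<epsilon>"
    unfolding uniformly_continuous_on_def using assms by metis
  have "\<bar>fibre_map n \<theta> x - fibre_map n \<theta> y\<bar> < \<epsilon>" if "x \<in> {0..1}" "y \<in> {0..1}" "\<bar>x - y\<bar> < \<eta>" for \<theta> x y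
  proof -
    obtain t where t: "\<theta> = abs_circle t" "0 \<le> t" "t \<le> 1"
      by (rule circle_cases)
    have "dist (?g (t, x)) (?g (t, y)) < \<epsilon>"
      using that t by (intro \<eta>(2)) (auto simp: dist_Pair_Pair dist_real_def)
    then show ?thesis
      by (simp add: t(1) fibre_map_def dist_real_def)
  qed
  with \<eta>(1) show ?thesis
    by blast
qed

lemma fibre_map_modulus_upto:
  assumes "\<epsilon> > 0"
  shows "\<exists>\<eta>>0. \<forall>k\<le>N. \<forall>\<theta>. \<forall>x\<in>{0..1}. \<forall>y\<in>{0..1}. \<bar>x - y\<bar> < \<eta> \<longrightarrow>
    \<bar>fibre_map k \<theta> x - fibre_map k \<theta> y\<bar> < \<epsilon>"
proof (induction N)
  case 0
  then show ?case
    using assms by (intro exI[of _ \<epsilon>]) auto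
next
  case (Suc N)
  then obtain \<eta> where \<eta>: "\<eta> > 0" "\<And>k \<theta> x y. k \<le> N \<Longrightarrow> x \<in> {0..1} \<Longrightarrow> y \<in> {0..1} \<Longrightarrow> \<bar>x - y\<bar> < \<eta> \<Longrightarrow>
    \<bar>fibre_map k \<theta> x - fibre_map k \<theta> y\<bar> < \<epsilon>"
    by blast
  from fibre_map_modulus[OF assms, of "Suc N"] obtain \<eta>' where \<eta>': "\<eta>' > 0"
    "\<And>\<theta> x y. x \<in> {0..1} \<Longrightarrow> y \<in> {0..1} \<Longrightarrow> \<bar>x - y\<bar> < \<eta>' \<Longrightarrow>
      \<bar>fibre_map (Suc N) \<theta> x - fibre_map (Suc N) \<theta> y\<bar> < \<epsilon>"
    by blast
  show ?case
    using \<eta> \<eta>' by (intro exI[of _ "min \<eta> \<eta>'"]) (simp add: le_Suc_eq)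
qed

section \<open>Generic fibres of a horseshoe\<close>

text \<open>The rotation is injective, so only the fibre over \<open>\<theta>\<close> is mapped into
  the fibre over \<open>rotation \<omega> \<theta>\<close>.\<close>

lemma image_fibre:
  assumes "P \<subseteq> Omega" "\<And>x. (\<theta>, x) \<in> P \<longleftrightarrow> x = c"
  shows "upper (F ` P) (rotation \<omega> \<theta>) = f (\<theta>, c)" "lower (F ` P) (rotation \<omega> \<theta>) = f (\<theta>, c)"
proof -
  have F: "F p = (rotation \<omega> (fst p), f p)" if "p \<in> P" for p
    using that assms(1) F_eq[of "snd p" "fst p"] by (auto simp: Omega_def)
  have inj: "\<psi> = \<theta>" if "rotation \<omega> \<psi> = rotation \<omega> \<theta>" for \<psi>
    using that by (metis rotation_inverse(1))
  have "(rotation \<omega> \<theta>, y) \<in> F ` P \<longleftrightarrow> y = f (\<theta>, c)" for y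
  proof
    assume "(rotation \<omega> \<theta>, y) \<in> F ` P"
    then obtain p where p: "p \<in> P" "(rotation \<omega> \<theta>, y) = F p"
      by blast
    then have "fst p = \<theta>" "y = f p"
      using F[OF p(1)] inj[of "fst p"] by simp_all
    then show "y = f (\<theta>, c)"
      using p(1) assms(2)[of "snd p"] by (metis prod.collapse)
  next
    assume "y = f (\<theta>, c)"
    moreover have "(\<theta>, c) \<in> P"
      using assms(2) by simp
    ultimately show "(rotation \<omega> \<theta>, y) \<in> F ` P"
      using F[of "(\<theta>, c)"] by (metis fst_conv imageI)
  qed
  then show "upper (F ` P) (rotation \<omega> \<theta>) = f (\<theta>, c)" "lower (F ` P) (rotation \<omega> \<theta>) = f (\<theta>, c)"
    by (rule upper_lower_singleton_fibre)+
qed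

text \<open>Over generic points the covers have one-point fibres, so the two alternatives in
  \<open>band_covers\<close> become inequalities for the images of the two ends of the fibre of
  \<open>A\<close>. They are the orientation preserving and reversing cases, and the intermediate
  value theorem settles either.\<close>

lemma residual_band_covers:
  assumes A: "strip A" and B: "strip B" and "band_covers F A B"
  shows "residual {\<theta>. {lower B (rotation \<omega> \<theta>)..upper B (rotation \<omega> \<theta>)}
    \<subseteq> fibre_map (Suc 0) \<theta> ` {lower A \<theta>..upper A \<theta>}}"
proof -
  let ?R = "rotation \<omega>"
  \<comment> \<open>Continuity of the ends of \<open>B\<close> is required at the rotated point,
    over which the image of the fibre of \<open>A\<close> lies.\<close>
  let ?K = "{\<theta>. isCont (lower A) \<theta>} \<inter> {\<theta>. isCont (upper A) \<theta>} \<inter>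
    ?R -` ({\<theta>. isCont (lower B) \<theta>} \<inter> {\<theta>. isCont (upper B) \<theta>})"
  have K: "residual ?K"
    by (intro residual_Int residual_vimage_rotation residual_isCont_lower residual_isCont_upper A B)
  have fibres: "upper (F ` bottom_cover A) (?R \<theta>) = f (\<theta>, lower A \<theta>)"
    "lower (F ` bottom_cover A) (?R \<theta>) = f (\<theta>, lower A \<theta>)"
    "upper (F ` top_cover A) (?R \<theta>) = f (\<theta>, upper A \<theta>)"
    "lower (F ` top_cover A) (?R \<theta>) = f (\<theta>, upper A \<theta>)"
    "upper (top_cover B) (?R \<theta>) = upper B (?R \<theta>)"
    "lower (top_cover B) (?R \<theta>) = upper B (?R \<theta>)"
    "upper (bottom_cover B) (?R \<theta>) = lower B (?R \<theta>)"
    "lower (bottom_cover B) (?R \<theta>) = lower B (?R \<theta>)" if "\<theta> \<in> ?K" for \<theta>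
  proof -
    have "isCont (lower A) \<theta>" "isCont (upper A) \<theta>" "isCont (lower B) (?R \<theta>)" "isCont (upper B) (?R \<theta>)"
      using that by auto
    note c = bottom_cover_fibre[OF this(1)] top_cover_fibre[OF this(2)]
      bottom_cover_fibre[OF this(3)] top_cover_fibre[OF this(4)]
    show "upper (F ` bottom_cover A) (?R \<theta>) = f (\<theta>, lower A \<theta>)"
      "lower (F ` bottom_cover A) (?R \<theta>) = f (\<theta>, lower A \<theta>)"
      by (rule image_fibre[OF cover_subset_Omega(1)[OF A] c(1)])+
    show "upper (F ` top_cover A) (?R \<theta>) = f (\<theta>, upper A \<theta>)"
      "lower (F ` top_cover A) (?R \<theta>) = f (\<theta>, upper A \<theta>)"
      by (rule image_fibre[OF cover_subset_Omega(2)[OF A] c(2)])+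
    show "upper (top_cover B) (?R \<theta>) = upper B (?R \<theta>)"
      "lower (top_cover B) (?R \<theta>) = upper B (?R \<theta>)"
      by (rule upper_lower_singleton_fibre[OF c(4)])+
    show "upper (bottom_cover B) (?R \<theta>) = lower B (?R \<theta>)"
      "lower (bottom_cover B) (?R \<theta>) = lower B (?R \<theta>)"
      by (rule upper_lower_singleton_fibre[OF c(3)])+
  qed
  have range: "{lower A \<theta>..upper A \<theta>} \<subseteq> {0..1}" "lower A \<theta> \<le> upper A \<theta>" for \<theta>
    using strip_fibre(5-7)[OF A, of \<theta>] by auto
  have cont: "continuous_on {lower A \<theta>..upper A \<theta>} (fibre_map (Suc 0) \<theta>)" for \<theta>
    using continuous_on_subset[OF continuous_on_fibre_map range(1)] .
  have ends: "fibre_map (Suc 0) \<theta> (lower A \<theta>) = f (\<theta>, lower A \<theta>)"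
    "fibre_map (Suc 0) \<theta> (upper A \<theta>) = f (\<theta>, upper A \<theta>)" for \<theta>
    by (rule fibre_map_1, use range[of \<theta>] in auto)+
  from assms(3) consider
    "strip_le (F ` bottom_cover A) (bottom_cover B)" "strip_le (top_cover B) (F ` top_cover A)" |
    "strip_le (top_cover B) (F ` bottom_cover A)" "strip_le (F ` top_cover A) (bottom_cover B)"
    unfolding band_covers_def by blast
  then show ?thesis
  proof cases
    case 1
    then obtain G H where G: "residual G" "residual H"
      "\<And>\<theta>. \<theta> \<in> G \<Longrightarrow> upper (F ` bottom_cover A) \<theta> \<le> lower (bottom_cover B) \<theta>"
      "\<And>\<theta>. \<theta> \<in> H \<Longrightarrow> upper (top_cover B) \<theta> \<le> lower (F ` top_cover A) \<theta>"
      unfolding strip_le_def by blast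
    have "residual (?K \<inter> ?R -` (G \<inter> H))"
      by (intro residual_Int residual_vimage_rotation K G)
    then show ?thesis
    proof (rule residual_mono, intro subsetI CollectI)
      fix \<theta> y assume \<theta>: "\<theta> \<in> ?K \<inter> ?R -` (G \<inter> H)" and y: "y \<in> {lower B (?R \<theta>)..upper B (?R \<theta>)}"
      then have "\<theta> \<in> ?K" "?R \<theta> \<in> G" "?R \<theta> \<in> H"
        by auto
      then have "fibre_map (Suc 0) \<theta> (lower A \<theta>) \<le> y" "y \<le> fibre_map (Suc 0) \<theta> (upper A \<theta>)"
        using G(3)[of "?R \<theta>"] G(4)[of "?R \<theta>"] y by (auto simp: fibres ends)
      then obtain x where "lower A \<theta> \<le> x" "x \<le> upper A \<theta>" "fibre_map (Suc 0) \<theta> x = y"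
        using IVT'[OF _ _ range(2) cont] by blast
      then show "y \<in> fibre_map (Suc 0) \<theta> ` {lower A \<theta>..upper A \<theta>}"
        by force
    qed
  next
    case 2
    then obtain G H where G: "residual G" "residual H"
      "\<And>\<theta>. \<theta> \<in> G \<Longrightarrow> upper (top_cover B) \<theta> \<le> lower (F ` bottom_cover A) \<theta>"
      "\<And>\<theta>. \<theta> \<in> H \<Longrightarrow> upper (F ` top_cover A) \<theta> \<le> lower (bottom_cover B) \<theta>"
      unfolding strip_le_def by blast
    have "residual (?K \<inter> ?R -` (G \<inter> H))"
      by (intro residual_Int residual_vimage_rotation K G)
    then show ?thesis
    proof (rule residual_mono, intro subsetI CollectI)
      fix \<theta> y assume \<theta>: "\<theta> \<in> ?K \<inter> ?R -` (G \<inter> H)" and y: "y \<in> {lower B (?R \<theta>)..upper B (?R \<theta>)}"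
      then have "\<theta> \<in> ?K" "?R \<theta> \<in> G" "?R \<theta> \<in> H"
        by auto
      then have "fibre_map (Suc 0) \<theta> (upper A \<theta>) \<le> y" "y \<le> fibre_map (Suc 0) \<theta> (lower A \<theta>)"
        using G(3)[of "?R \<theta>"] G(4)[of "?R \<theta>"] y by (auto simp: fibres ends)
      then obtain x where "lower A \<theta> \<le> x" "x \<le> upper A \<theta>" "fibre_map (Suc 0) \<theta> x = y"
        using IVT2'[OF _ _ range(2) cont] by blast
      then show "y \<in> fibre_map (Suc 0) \<theta> ` {lower A \<theta>..upper A \<theta>}"
        by force
    qed
  qed
qed

end

text \<open>In either order, generic fibres meet at most in a common end point, hence the open
  intervals.\<close>

lemma residual_weakly_ordered:
  assumes "weakly_ordered A B"
  shows "residual {\<theta>. disjnt {lower A \<theta><..<upper A \<theta>} {lower B \<theta><..<upper B \<theta>}}"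
proof -
  consider "strip_le A B" | "strip_le B A"
    using assms unfolding weakly_ordered_def by blast
  then show ?thesis
  proof cases
    case 1
    then obtain G where G: "residual G" "\<And>\<theta>. \<theta> \<in> G \<Longrightarrow> upper A \<theta> \<le> lower B \<theta>"
      unfolding strip_le_def by blast
    from G(1) show ?thesis
      by (rule residual_mono) (use G(2) in \<open>auto simp: disjnt_def dest!: G(2)\<close>)
  next
    case 2
    then obtain G where G: "residual G" "\<And>\<theta>. \<theta> \<in> G \<Longrightarrow> upper B \<theta> \<le> lower A \<theta>"
      unfolding strip_le_def by blast
    from G(1) show ?thesis
      by (rule residual_mono) (use G(2) in \<open>auto simp: disjnt_def dest!: G(2)\<close>)
  qed
qed

text \<open>The covering and order relations between bands enter only through their consequences
  over each point of a forward invariant set \<open>G\<close>. The interiors and the inclusions in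
  \<open>J\<close> serve to bound the fibres of \<open>J\<close> from below.\<close>

locale horseshoe_on_fibres = skew_product +
  fixes s :: nat and J :: "(circle \<times> real) set" and \<D> :: "(circle \<times> real) set set" and G :: "circle set"
  assumes strip_J: "strip J"
    and strip_\<D>: "\<And>L. L \<in> \<D> \<Longrightarrow> strip L"
    and \<D>_interior: "\<And>L. L \<in> \<D> \<Longrightarrow> top_of_set Omega interior_of L \<noteq> {}"
    and \<D>_subset_J: "\<And>L. L \<in> \<D> \<Longrightarrow> L \<subseteq> J"
    and card_\<D>: "card \<D> = s" "s \<ge> 2"
    and G_nonempty: "G \<noteq> {}"
    and G_rotation: "\<And>\<theta> n. \<theta> \<in> G \<Longrightarrow> rotation (real n * \<omega>) \<theta> \<in> G"
    and G_covers: "\<And>\<theta> L. \<theta> \<in> G \<Longrightarrow> L \<in> \<D> \<Longrightarrow>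
      {lower J (rotation \<omega> \<theta>)..upper J (rotation \<omega> \<theta>)}
        \<subseteq> fibre_map (Suc 0) \<theta> ` {lower L \<theta>..upper L \<theta>}"
    and G_disjoint: "\<And>\<theta> L M. \<theta> \<in> G \<Longrightarrow> L \<in> \<D> \<Longrightarrow> M \<in> \<D> \<Longrightarrow> L \<noteq> M \<Longrightarrow>
      disjnt {lower L \<theta><..<upper L \<theta>} {lower M \<theta><..<upper M \<theta>}"

text \<open>Countably many generic conditions, imposed along the whole forward orbit, still define a
  residual set, and that set is forward invariant.\<close>

lemma (in skew_product) horseshoe_on_generic_fibres:
  assumes "horseshoe F s J \<D>"
  shows "\<exists>G. horseshoe_on_fibres F \<omega> f s J \<D> G"
proof -
  have J: "strip J" and s: "s \<ge> 2" "card \<D> = s" and order: "pairwise weakly_ordered \<D>"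
    using assms by (simp_all add: horseshoe_def band_def)
  have \<D>: "strip L" "top_of_set Omega interior_of L \<noteq> {}" "L \<subseteq> J" "band_covers F L J" if "L \<in> \<D>" for L
    using assms that by (simp_all add: horseshoe_def band_def)
  \<comment> \<open>An infinite set has \<open>card\<close> 0, so \<open>s \<ge> 2\<close> forces
    \<open>\<D>\<close> to be finite.\<close>
  have "countable \<D>"
    using s by (intro countable_finite card_ge_0_finite) simp
  let ?C = "\<lambda>L. {\<theta>. {lower J (rotation \<omega> \<theta>)..upper J (rotation \<omega> \<theta>)}
        \<subseteq> fibre_map (Suc 0) \<theta> ` {lower L \<theta>..upper L \<theta>}}"
  let ?D = "\<lambda>L M. {\<theta>. disjnt {lower L \<theta><..<upper L \<theta>} {lower M \<theta><..<upper M \<theta>}}"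
  let ?R = "\<lambda>n::nat. rotation (real n * \<omega>)"
  define H where "H = (\<Inter>L\<in>\<D>. ?C L) \<inter> (\<Inter>L\<in>\<D>. \<Inter>M\<in>\<D> - {L}. ?D L M)"
  have "residual (?C L)" if "L \<in> \<D>" for L
    using residual_band_covers[OF \<D>(1)[OF that] J \<D>(4)[OF that]] .
  moreover have "residual (?D L M)" if "L \<in> \<D>" "M \<in> \<D> - {L}" for L M
    using order that by (intro residual_weakly_ordered) (auto simp: pairwise_def)
  ultimately have "residual H"
    unfolding H_def using \<open>countable \<D>\<close>
    by (intro residual_Int residual_INT) auto
  then have "residual (\<Inter>n. ?R n -` H)"
    by (intro residual_INT residual_vimage_rotation) auto
  then have nonempty: "(\<Inter>n. ?R n -` H) \<noteq> {}"
    by (rule residual_circle_nonempty)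
  have sub: "\<theta> \<in> H" if "\<theta> \<in> (\<Inter>n. ?R n -` H)" for \<theta>
  proof -
    have "?R 0 \<theta> \<in> H"
      using that by blast
    then show ?thesis
      by simp
  qed
  have inv: "?R n \<theta> \<in> (\<Inter>n. ?R n -` H)" if "\<theta> \<in> (\<Inter>n. ?R n -` H)" for \<theta> n
  proof (intro INT_I vimageI2)
    fix m
    have "?R (m + n) \<theta> \<in> H"
      using that by blast
    then show "?R m (?R n \<theta>) \<in> H"
      by (simp add: rotation_add algebra_simps)
  qed
  have "horseshoe_on_fibres F \<omega> f s J \<D> (\<Inter>n. ?R n -` H)"
  proof unfold_locales
    fix \<theta> L assume "\<theta> \<in> (\<Inter>n. ?R n -` H)" "L \<in> \<D>"
    then show "{lower J (rotation \<omega> \<theta>)..upper J (rotation \<omega> \<theta>)}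
        \<subseteq> fibre_map (Suc 0) \<theta> ` {lower L \<theta>..upper L \<theta>}"
      using sub[of \<theta>] unfolding H_def by blast
  next
    fix \<theta> L M assume "\<theta> \<in> (\<Inter>n. ?R n -` H)" "L \<in> \<D>" "M \<in> \<D>" "L \<noteq> M"
    then show "disjnt {lower L \<theta><..<upper L \<theta>} {lower M \<theta><..<upper M \<theta>}"
      using sub[of \<theta>] unfolding H_def by blast
  next
    show "rotation (real n * \<omega>) \<theta> \<in> (\<Inter>n. ?R n -` H)" if "\<theta> \<in> (\<Inter>n. ?R n -` H)" for \<theta> n
      by (rule inv[OF that])
  qed (fact J s nonempty \<D>)+
  then show ?thesis
    by blast
qed

section \<open>Itineraries and separated orbits in generic fibres\<close>

context horseshoe_on_fibres
begin

abbreviation fibre_J :: "circle \<Rightarrow> real set"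
  where "fibre_J \<theta> \<equiv> {lower J \<theta>..upper J \<theta>}"

lemma fibre_J_subset: "fibre_J \<theta> \<subseteq> {0..1}"
  using strip_fibre(5-7)[OF strip_J, of \<theta>] by auto

lemma fibre_J_ends: "lower J \<theta> \<in> fibre_J \<theta>" "upper J \<theta> \<in> fibre_J \<theta>"
  using strip_fibre(6)[OF strip_J, of \<theta>] by auto

lemma fibre_L_bounds:
  assumes "L \<in> \<D>"
  shows "lower J \<theta> \<le> lower L \<theta>" "upper L \<theta> \<le> upper J \<theta>"
  using strip_fibre(1,2)[OF strip_\<D>[OF assms], of \<theta>] \<D>_subset_J[OF assms]
    strip_fibre(3,4)[OF strip_J] by blast+

lemma \<D>_nonempty: "\<D> \<noteq> {}"
  using card_\<D> by auto

text \<open>Any one member of \<open>\<D>\<close> suffices: its fibre is mapped over the next fibre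
  of \<open>J\<close>, and the inclusion in \<open>J\<close> lets the covering be iterated.\<close>

lemma fibre_J_covers:
  assumes "\<theta> \<in> G"
  shows "fibre_J (rotation (real n * \<omega>) \<theta>) \<subseteq> fibre_map n \<theta> ` fibre_J \<theta>"
proof (induction n)
  case (Suc n)
  let ?\<theta> = "rotation (real n * \<omega>) \<theta>"
  obtain L where L: "L \<in> \<D>"
    using \<D>_nonempty by blast
  have "fibre_J (rotation (real (Suc n) * \<omega>) \<theta>) = fibre_J (rotation \<omega> ?\<theta>)"
    by (simp add: rotation_add algebra_simps)
  also have "\<dots> \<subseteq> fibre_map (Suc 0) ?\<theta> ` {lower L ?\<theta>..upper L ?\<theta>}"
    by (intro G_covers G_rotation assms L)
  also have "\<dots> \<subseteq> fibre_map (Suc 0) ?\<theta> ` fibre_J ?\<theta>"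
    using fibre_L_bounds[OF L, of ?\<theta>] by (intro image_mono) auto
  also have "\<dots> \<subseteq> fibre_map (Suc 0) ?\<theta> ` fibre_map n \<theta> ` fibre_J \<theta>"
    using Suc by (rule image_mono)
  also have "\<dots> = fibre_map (Suc n) \<theta> ` fibre_J \<theta>"
    unfolding image_image using fibre_J_subset[of \<theta>] fibre_map_add[of _ n "Suc 0" \<theta>]
    by (intro image_cong) auto
  finally show ?case .
qed simp

text \<open>By minimality of the rotation, a short fibre of \<open>J\<close> would within boundedly many steps cover
  a fibre of \<open>J\<close> over the projection of a box inside some member of \<open>\<D>\<close>.\<close>
lemma fibre_J_length:
  obtains \<delta> where "\<delta> > 0" "\<And>\<theta>. \<theta> \<in> G \<Longrightarrow> \<delta> \<le> upper J \<theta> - lower J \<theta>"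
proof -
  obtain L where L: "L \<in> \<D>"
    using \<D>_nonempty by blast
  obtain V c where V: "open V" "V \<noteq> {}" "c > 0" "\<And>\<theta>. \<theta> \<in> V \<Longrightarrow> c \<le> upper L \<theta> - lower L \<theta>"
    using strip_interior_fibres[OF strip_\<D>[OF L] \<D>_interior[OF L]] by metis
  obtain N where N: "\<And>\<theta>. \<exists>k\<le>N. rotation (real k * \<omega>) \<theta> \<in> V"
    using rotation_uniform_hitting_time[OF irrational V(1,2)] by blast
  obtain \<eta> where \<eta>: "\<eta> > 0" "\<And>k \<theta> x y. k \<le> N \<Longrightarrow> x \<in> {0..1} \<Longrightarrow> y \<in> {0..1} \<Longrightarrow> \<bar>x - y\<bar> < \<eta> \<Longrightarrow>
      \<bar>fibre_map k \<theta> x - fibre_map k \<theta> y\<bar> < c"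
    using fibre_map_modulus_upto[OF V(3), of N] by blast
  have "\<eta> \<le> upper J \<theta> - lower J \<theta>" if "\<theta> \<in> G" for \<theta>
  proof -
    obtain k where k: "k \<le> N" "rotation (real k * \<omega>) \<theta> \<in> V"
      using N by blast
    let ?\<theta> = "rotation (real k * \<omega>) \<theta>"
    obtain x y where x: "x \<in> fibre_J \<theta>" "lower J ?\<theta> = fibre_map k \<theta> x"
      and y: "y \<in> fibre_J \<theta>" "upper J ?\<theta> = fibre_map k \<theta> y"
      using fibre_J_covers[OF \<open>\<theta> \<in> G\<close>, of k] fibre_J_ends[of ?\<theta>] by blast
    have "c \<le> upper J ?\<theta> - lower J ?\<theta>"
      using V(4)[OF k(2)] fibre_L_bounds[OF L, of ?\<theta>] by linarith
    then have "\<not> \<bar>x - y\<bar> < \<eta>"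
      using \<eta>(2)[OF k(1), of x y \<theta>] x y fibre_J_subset[of \<theta>] by fastforce
    then show ?thesis
      using x(1) y(1) by auto
  qed
  with \<eta>(1) show thesis
    by (rule that)
qed

lemma lower_J_less_upper_J: "\<theta> \<in> G \<Longrightarrow> lower J \<theta> < upper J \<theta>"
  using fibre_J_length by (metis diff_gt_0_iff_gt less_le_trans)

lemma fibre_map_horseshoe_1:
  assumes "\<theta> \<in> G"
  shows "\<exists>C. interval_horseshoe (fibre_map (Suc 0) \<theta>) (fibre_J \<theta>) (fibre_J (rotation \<omega> \<theta>)) C \<and> card C = s"
proof -
  let ?c = "\<lambda>L. (lower L \<theta>, upper L \<theta>)"
  have "rotation \<omega> \<theta> \<in> G"
    using G_rotation[OF assms, of 1] by simp
  then have J: "lower J (rotation \<omega> \<theta>) < upper J (rotation \<omega> \<theta>)"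
    by (rule lower_J_less_upper_J)
  \<comment> \<open>A one-point fibre could not be mapped over the next fibre of \<open>J\<close>,
    which has positive length.\<close>
  have less: "lower L \<theta> < upper L \<theta>" if "L \<in> \<D>" for L
  proof (rule ccontr)
    assume "\<not> lower L \<theta> < upper L \<theta>"
    then have eq: "{lower L \<theta>..upper L \<theta>} = {lower L \<theta>}"
      using strip_fibre(6)[OF strip_\<D>[OF that], of \<theta>] by auto
    have "fibre_J (rotation \<omega> \<theta>) \<subseteq> {fibre_map (Suc 0) \<theta> (lower L \<theta>)}"
      using G_covers[OF assms that] by (simp only: eq image_insert image_empty)
    then show False
      using fibre_J_ends[of "rotation \<omega> \<theta>"] J by (metis less_irrefl singletonD subsetD)
  qed
  have "L = M" if "L \<in> \<D>" "M \<in> \<D>" "?c L = ?c M" for L M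
  proof (rule ccontr)
    assume "L \<noteq> M"
    then have "disjnt {lower L \<theta><..<upper L \<theta>} {lower L \<theta><..<upper L \<theta>}"
      using G_disjoint[OF assms that(1,2)] that(3) by simp
    then show False
      using less[OF that(1)] by (simp add: disjnt_def)
  qed
  then have "inj_on ?c \<D>"
    by (intro inj_onI) blast
  then have "card (?c ` \<D>) = s"
    using card_\<D>(1) by (simp add: card_image)
  moreover have "interval_horseshoe (fibre_map (Suc 0) \<theta>) (fibre_J \<theta>) (fibre_J (rotation \<omega> \<theta>)) (?c ` \<D>)"
    unfolding interval_horseshoe_def
  proof (intro conjI ballI)
    show "finite (?c ` \<D>)"
      using card_\<D> by (intro finite_imageI card_ge_0_finite) simp
    show "pairwise (\<lambda>c d. disjnt {fst c<..<snd c} {fst d<..<snd d}) (?c ` \<D>)"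
      unfolding pairwise_def
    proof (intro ballI impI)
      fix c d assume "c \<in> ?c ` \<D>" "d \<in> ?c ` \<D>" "c \<noteq> d"
      then obtain L M where "L \<in> \<D>" "M \<in> \<D>" "L \<noteq> M" "c = ?c L" "d = ?c M"
        by blast
      then show "disjnt {fst c<..<snd c} {fst d<..<snd d}"
        using G_disjoint[OF assms] by simp
    qed
  next
    fix c assume "c \<in> ?c ` \<D>"
    then obtain L where L: "L \<in> \<D>" "c = ?c L"
      by blast
    then show "fst c < snd c" "fibre_J (rotation \<omega> \<theta>) \<subseteq> fibre_map (Suc 0) \<theta> ` {fst c..snd c}"
      using less G_covers[OF assms] by simp_all
    show "{fst c..snd c} \<subseteq> fibre_J \<theta>"
      using fibre_L_bounds[OF L(1), of \<theta>] L(2) by simp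
  qed
  ultimately show ?thesis
    by blast
qed

text \<open>The one-step horseshoe over \<open>\<theta>\<close> is composed with the
  \<open>n\<close>-step horseshoe over the rotated point, so the induction has to range over all of
  \<open>G\<close>. For \<open>n = 0\<close> the whole fibre is the single interval.\<close>

lemma fibre_map_horseshoe:
  assumes "\<theta> \<in> G"
  shows "\<exists>C. interval_horseshoe (fibre_map n \<theta>) (fibre_J \<theta>) (fibre_J (rotation (real n * \<omega>) \<theta>)) C \<and>
    card C = s ^ n"
  using assms
proof (induction n arbitrary: \<theta>)
  case 0
  have "interval_horseshoe (fibre_map 0 \<theta>) (fibre_J \<theta>) (fibre_J (rotation (real 0 * \<omega>) \<theta>))
      {(lower J \<theta>, upper J \<theta>)}"
    using lower_J_less_upper_J[OF 0] by (simp add: interval_horseshoe_def image_def)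
  moreover have "card {(lower J \<theta>, upper J \<theta>)} = s ^ 0"
    by simp
  ultimately show ?case
    by blast
next
  case (Suc n)
  let ?\<theta> = "rotation \<omega> \<theta>"
  have rot: "rotation (real n * \<omega>) ?\<theta> = rotation (real (Suc n) * \<omega>) \<theta>"
    by (simp add: rotation_add algebra_simps)
  have "?\<theta> \<in> G"
    using G_rotation[OF Suc.prems, of 1] by simp
  then obtain D where D: "interval_horseshoe (fibre_map n ?\<theta>) (fibre_J ?\<theta>)
      (fibre_J (rotation (real (Suc n) * \<omega>) \<theta>)) D" "card D = s ^ n"
    using Suc.IH[of ?\<theta>] unfolding rot by blast
  obtain C where C: "interval_horseshoe (fibre_map (Suc 0) \<theta>) (fibre_J \<theta>) (fibre_J ?\<theta>) C" "card C = s"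
    using fibre_map_horseshoe_1[OF Suc.prems] by blast
  have "continuous_on (fibre_J \<theta>) (fibre_map (Suc 0) \<theta>)"
    using continuous_on_fibre_map fibre_J_subset by (rule continuous_on_subset)
  from interval_horseshoe_compose[OF C(1) D(1) this] obtain E where
    E: "interval_horseshoe (fibre_map n ?\<theta> \<circ> fibre_map (Suc 0) \<theta>) (fibre_J \<theta>)
      (fibre_J (rotation (real (Suc n) * \<omega>) \<theta>)) E" "card E = s ^ Suc n"
    using C(2) D(2) by auto
  have "(fibre_map n ?\<theta> \<circ> fibre_map (Suc 0) \<theta>) x = fibre_map (Suc n) \<theta> x" if "x \<in> fibre_J \<theta>" for x
    using fibre_map_add[of x "Suc 0" n \<theta>] that fibre_J_subset[of \<theta>] by auto
  from interval_horseshoe_cong[OF this E(1)] E(2) show ?case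
    by (intro exI[of _ E] conjI)
qed

text \<open>The order of quantifiers is the point: \<open>\<delta>\<close> bounds all generic fibres
  of \<open>J\<close> and the modulus of continuity ignores the base point, so \<open>\<eta>\<close>
  depends on \<open>n\<close> only.\<close>

lemma separated_subfamilies:
  "\<exists>\<eta>>0. \<forall>\<theta>\<in>G. \<exists>C. (\<forall>c\<in>C. {fst c..snd c} \<subseteq> fibre_J \<theta> \<and>
        fibre_J (rotation (real n * \<omega>) \<theta>) \<subseteq> fibre_map n \<theta> ` {fst c..snd c}) \<and>
      finite C \<and> s ^ n \<le> 2 * card C \<and> pairwise (\<lambda>c d. snd c + \<eta> \<le> fst d \<or> snd d + \<eta> \<le> fst c) C"
proof -
  obtain \<delta> where \<delta>: "\<delta> > 0" "\<And>\<theta>. \<theta> \<in> G \<Longrightarrow> \<delta> \<le> upper J \<theta> - lower J \<theta>"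
    using fibre_J_length by blast
  obtain \<eta> where \<eta>: "\<eta> > 0" "\<And>\<theta> x y. x \<in> {0..1} \<Longrightarrow> y \<in> {0..1} \<Longrightarrow> \<bar>x - y\<bar> < \<eta> \<Longrightarrow>
      \<bar>fibre_map n \<theta> x - fibre_map n \<theta> y\<bar> < \<delta>"
    using fibre_map_modulus[OF \<delta>(1), of n] by blast
  show ?thesis
  proof (rule exI[of _ \<eta>], intro conjI ballI)
    fix \<theta> assume \<theta>: "\<theta> \<in> G"
    let ?\<theta> = "rotation (real n * \<omega>) \<theta>"
    obtain C where C: "interval_horseshoe (fibre_map n \<theta>) (fibre_J \<theta>) (fibre_J ?\<theta>) C" "card C = s ^ n"
      using fibre_map_horseshoe[OF \<theta>] by blast
    have "\<bar>fibre_map n \<theta> x - fibre_map n \<theta> y\<bar> < \<delta>"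
      if "x \<in> fibre_J \<theta>" "y \<in> fibre_J \<theta>" "\<bar>x - y\<bar> < \<eta>" for x y
      using that fibre_J_subset[of \<theta>] by (intro \<eta>(2)) auto
    \<comment> \<open>The two ends of the fibre of \<open>J\<close> reached after \<open>n\<close>
      steps are the far apart points that every interval has to cover.\<close>
    moreover have "\<delta> \<le> \<bar>upper J ?\<theta> - lower J ?\<theta>\<bar>"
      using \<delta>(2)[OF G_rotation[OF \<theta>, of n]] by linarith
    ultimately obtain E where E: "E \<subseteq> C" "card C \<le> 2 * card E"
        "pairwise (\<lambda>c d. snd c + \<eta> \<le> fst d \<or> snd d + \<eta> \<le> fst c) E"
      using interval_horseshoe_separated_half[OF C(1) \<eta>(1) _ fibre_J_ends(2,1)] by blast
    show "\<exists>C. (\<forall>c\<in>C. {fst c..snd c} \<subseteq> fibre_J \<theta> \<and>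
        fibre_J ?\<theta> \<subseteq> fibre_map n \<theta> ` {fst c..snd c}) \<and>
      finite C \<and> s ^ n \<le> 2 * card C \<and> pairwise (\<lambda>c d. snd c + \<eta> \<le> fst d \<or> snd d + \<eta> \<le> fst c) C"
    proof (intro exI[of _ E] conjI ballI)
      show "finite E"
        using E(1) C(1) unfolding interval_horseshoe_def by (blast intro: finite_subset)
      show "s ^ n \<le> 2 * card E"
        using E(2) C(2) by simp
      show "{fst c..snd c} \<subseteq> fibre_J \<theta>" "fibre_J ?\<theta> \<subseteq> fibre_map n \<theta> ` {fst c..snd c}" if "c \<in> E" for c
        using subsetD[OF E(1) that] C(1) by (simp_all add: interval_horseshoe_def)
    qed (rule E(3))
  qed (rule \<eta>(1))
qed

text \<open>Orbits are coded by one gapped interval per block of \<open>n\<close> steps. At least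
  half of the \<open>s ^ n\<close> intervals are available, and their number is an integer, whence
  the rounded up half \<open>(s ^ n + 1) div 2\<close>.\<close>

lemma separated_points:
  "\<exists>\<eta>>0. \<forall>\<theta>\<in>G. \<forall>k. \<exists>E\<subseteq>{0..1}. finite E \<and> ((s ^ n + 1) div 2) ^ k \<le> card E \<and>
      (\<forall>x\<in>E. \<forall>y\<in>E. x \<noteq> y \<longrightarrow> (\<exists>i<k. \<eta> \<le> \<bar>fibre_map (n * i) \<theta> x - fibre_map (n * i) \<theta> y\<bar>))"
proof -
  obtain \<eta> where "\<eta> > 0" and \<eta>: "\<forall>\<theta>\<in>G. \<exists>C. (\<forall>c\<in>C. {fst c..snd c} \<subseteq> fibre_J \<theta> \<and>
        fibre_J (rotation (real n * \<omega>) \<theta>) \<subseteq> fibre_map n \<theta> ` {fst c..snd c}) \<and>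
      finite C \<and> s ^ n \<le> 2 * card C \<and> pairwise (\<lambda>c d. snd c + \<eta> \<le> fst d \<or> snd d + \<eta> \<le> fst c) C"
    using separated_subfamilies[of n] by (elim exE conjE)
  let ?q = "(s ^ n + 1) div 2"
  have main: "\<exists>E\<subseteq>fibre_J \<theta>. finite E \<and> ?q ^ k \<le> card E \<and>
      (\<forall>x\<in>E. \<forall>y\<in>E. x \<noteq> y \<longrightarrow> (\<exists>i<k. \<eta> \<le> \<bar>fibre_map (n * i) \<theta> x - fibre_map (n * i) \<theta> y\<bar>))"
    if "\<theta> \<in> G" for \<theta> k
    using that
  proof (induction k arbitrary: \<theta>)
    case 0
    then show ?case
      using fibre_J_ends(1)[of \<theta>] by (intro exI[of _ "{lower J \<theta>}"]) simp
  next
    case (Suc k)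
    let ?\<theta> = "rotation (real n * \<omega>) \<theta>"
    from Suc.IH[OF G_rotation[OF Suc.prems, of n]] obtain E where
      E: "E \<subseteq> fibre_J ?\<theta>" "finite E" "?q ^ k \<le> card E"
      "\<And>x y. x \<in> E \<Longrightarrow> y \<in> E \<Longrightarrow> x \<noteq> y \<Longrightarrow>
        \<exists>i<k. \<eta> \<le> \<bar>fibre_map (n * i) ?\<theta> x - fibre_map (n * i) ?\<theta> y\<bar>"
      by blast
    from bspec[OF \<eta> Suc.prems] obtain C where
      C: "\<forall>c\<in>C. {fst c..snd c} \<subseteq> fibre_J \<theta> \<and> fibre_J ?\<theta> \<subseteq> fibre_map n \<theta> ` {fst c..snd c}"
      and card_C: "finite C" "s ^ n \<le> 2 * card C"
      and gaps: "pairwise (\<lambda>c d. snd c + \<eta> \<le> fst d \<or> snd d + \<eta> \<le> fst c) C"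
      by (elim exE conjE)
    have C_subset: "{fst c..snd c} \<subseteq> fibre_J \<theta>" if "c \<in> C" for c
      using bspec[OF C that] by (rule conjunct1)
    have C_covers: "fibre_J ?\<theta> \<subseteq> fibre_map n \<theta> ` {fst c..snd c}" if "c \<in> C" for c
      using bspec[OF C that] by (rule conjunct2)
    \<comment> \<open>A point for the pair \<open>p\<close> starts in the interval
      \<open>fst p\<close> and lands on the point \<open>snd p\<close> after one block.\<close>
    have "\<forall>p\<in>C \<times> E. \<exists>x. x \<in> {fst (fst p)..snd (fst p)} \<and> fibre_map n \<theta> x = snd p"
    proof
      fix p assume p: "p \<in> C \<times> E"
      then have "snd p \<in> fibre_map n \<theta> ` {fst (fst p)..snd (fst p)}"
        using C_covers[of "fst p"] E(1) by (metis mem_Times_iff subsetD)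
      then obtain x where "snd p = fibre_map n \<theta> x" "x \<in> {fst (fst p)..snd (fst p)}"
        by (rule imageE)
      then show "\<exists>x. x \<in> {fst (fst p)..snd (fst p)} \<and> fibre_map n \<theta> x = snd p"
        by (intro exI[of _ x]) simp
    qed
    from bchoice[OF this] obtain X where
      X: "\<forall>p\<in>C \<times> E. X p \<in> {fst (fst p)..snd (fst p)} \<and> fibre_map n \<theta> (X p) = snd p" ..
    have sep: "\<exists>i<Suc k. \<eta> \<le> \<bar>fibre_map (n * i) \<theta> (X p) - fibre_map (n * i) \<theta> (X p')\<bar>"
      if "p \<in> C \<times> E" "p' \<in> C \<times> E" "p \<noteq> p'" for p p'
    proof -
      have pp: "fst p \<in> C" "fst p' \<in> C" "snd p \<in> E" "snd p' \<in> E"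
        using that(1,2) by auto
      have Xp: "X p \<in> {fst (fst p)..snd (fst p)}" "fibre_map n \<theta> (X p) = snd p"
        and Xp': "X p' \<in> {fst (fst p')..snd (fst p')}" "fibre_map n \<theta> (X p') = snd p'"
        using X that(1,2) by blast+
      \<comment> \<open>Different intervals separate at time 0 by the gap; different targets
        separate one block later than they do over the rotated point.\<close>
      consider "fst p \<noteq> fst p'" | "snd p \<noteq> snd p'"
        using \<open>p \<noteq> p'\<close> by (metis prod.collapse)
      then show ?thesis
      proof cases
        case 1
        then have "snd (fst p) + \<eta> \<le> fst (fst p') \<or> snd (fst p') + \<eta> \<le> fst (fst p)"
          using gaps pp(1,2) unfolding pairwise_def by blast
        then have "\<eta> \<le> \<bar>X p - X p'\<bar>"
          using Xp(1) Xp'(1) by auto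
        then show ?thesis
          by (intro exI[of _ 0]) simp
      next
        case 2
        then obtain i where i: "i < k" "\<eta> \<le> \<bar>fibre_map (n * i) ?\<theta> (snd p) - fibre_map (n * i) ?\<theta> (snd p')\<bar>"
          using E(4) pp(3,4) by blast
        have "X p \<in> {0..1}" "X p' \<in> {0..1}"
          using Xp(1) Xp'(1) C_subset[OF pp(1)] C_subset[OF pp(2)] fibre_J_subset[of \<theta>] by blast+
        then have "fibre_map (n * Suc i) \<theta> (X p) = fibre_map (n * i) ?\<theta> (snd p)"
          "fibre_map (n * Suc i) \<theta> (X p') = fibre_map (n * i) ?\<theta> (snd p')"
          using Xp(2) Xp'(2) by (simp_all add: fibre_map_add)
        with i show ?thesis
          by (intro exI[of _ "Suc i"]) simp
      qed
    qed
    have "inj_on X (C \<times> E)"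
    proof (rule inj_onI, rule ccontr)
      fix p p' assume "p \<in> C \<times> E" "p' \<in> C \<times> E" "X p = X p'" "p \<noteq> p'"
      then show False
        using sep[of p p'] \<open>\<eta> > 0\<close> by auto
    qed
    then have "card (X ` (C \<times> E)) = card C * card E"
      by (simp add: card_image card_cartesian_product)
    moreover have "?q \<le> card C"
      using card_C(2) by simp
    ultimately have "?q ^ Suc k \<le> card (X ` (C \<times> E))"
      using E(3) by (simp add: mult_le_mono)
    moreover have "X ` (C \<times> E) \<subseteq> fibre_J \<theta>"
    proof (intro image_subsetI)
      fix p assume "p \<in> C \<times> E"
      then have "X p \<in> {fst (fst p)..snd (fst p)}" "fst p \<in> C"
        using X by auto
      then show "X p \<in> fibre_J \<theta>"
        using C_subset by blast
    qed
    moreover have "finite (X ` (C \<times> E))"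
      using card_C(1) E(2) by simp
    moreover have "\<forall>x\<in>X ` (C \<times> E). \<forall>y\<in>X ` (C \<times> E). x \<noteq> y \<longrightarrow>
        (\<exists>i<Suc k. \<eta> \<le> \<bar>fibre_map (n * i) \<theta> x - fibre_map (n * i) \<theta> y\<bar>)"
    proof (intro ballI impI)
      fix x y assume "x \<in> X ` (C \<times> E)" "y \<in> X ` (C \<times> E)" "x \<noteq> y"
      then obtain p p' where "p \<in> C \<times> E" "p' \<in> C \<times> E" "x = X p" "y = X p'" "p \<noteq> p'"
        by blast
      then show "\<exists>i<Suc k. \<eta> \<le> \<bar>fibre_map (n * i) \<theta> x - fibre_map (n * i) \<theta> y\<bar>"
        using sep[of p p'] by simp
    qed
    ultimately show ?case
      by (intro exI[of _ "X ` (C \<times> E)"] conjI)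
  qed
  show ?thesis
  proof (rule exI[of _ \<eta>], intro conjI ballI allI)
    fix \<theta> k assume "\<theta> \<in> G"
    from main[OF this, of k] obtain E where "E \<subseteq> fibre_J \<theta>" "finite E" "?q ^ k \<le> card E"
      "\<forall>x\<in>E. \<forall>y\<in>E. x \<noteq> y \<longrightarrow> (\<exists>i<k. \<eta> \<le> \<bar>fibre_map (n * i) \<theta> x - fibre_map (n * i) \<theta> y\<bar>)"
      by (elim exE conjE)
    moreover from this(1) have "E \<subseteq> {0..1}"
      using fibre_J_subset by (rule order_trans)
    ultimately show "\<exists>E\<subseteq>{0..1}. finite E \<and> ?q ^ k \<le> card E \<and>
      (\<forall>x\<in>E. \<forall>y\<in>E. x \<noteq> y \<longrightarrow> (\<exists>i<k. \<eta> \<le> \<bar>fibre_map (n * i) \<theta> x - fibre_map (n * i) \<theta> y\<bar>))"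
      by (intro exI[of _ E] conjI)
  qed (rule \<open>\<eta> > 0\<close>)
qed

end

section \<open>Lower bounds for the entropy\<close>

lemma iterated_cover:
  assumes "open_cover X \<U>" "finite \<U>" "T ` topspace X \<subseteq> topspace X"
  shows "finite (iterated_cover X T n \<U>)" "\<Union>(iterated_cover X T n \<U>) = topspace X"
proof -
  let ?S = "\<lambda>U. {x \<in> topspace X. \<forall>i<n. (T ^^ i) x \<in> U i}"
  \<comment> \<open>Only the values of \<open>U\<close> below \<open>n\<close> matter; restricting
    to them leaves finitely many choices.\<close>
  have "iterated_cover X T n \<U> \<subseteq> ?S ` PiE {..<n} (\<lambda>_. \<U>)"
  proof
    fix A assume "A \<in> iterated_cover X T n \<U>"
    then obtain U where U: "A = ?S U" "\<forall>i<n. U i \<in> \<U>"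
      unfolding iterated_cover_def by blast
    have "A = ?S (restrict U {..<n})"
      using U(1) by auto
    moreover have "restrict U {..<n} \<in> PiE {..<n} (\<lambda>_. \<U>)"
      using U(2) by auto
    ultimately show "A \<in> ?S ` PiE {..<n} (\<lambda>_. \<U>)"
      by (rule image_eqI)
  qed
  then show "finite (iterated_cover X T n \<U>)"
    by (rule finite_subset) (intro finite_imageI finite_PiE finite_lessThan assms(2))
  have iterate: "(T ^^ i) x \<in> topspace X" if "x \<in> topspace X" for i x
    using that assms(3) by (induction i) auto
  show "\<Union>(iterated_cover X T n \<U>) = topspace X"
  proof
    show "\<Union>(iterated_cover X T n \<U>) \<subseteq> topspace X"
      unfolding iterated_cover_def by blast
    show "topspace X \<subseteq> \<Union>(iterated_cover X T n \<U>)"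
    proof
      fix x assume x: "x \<in> topspace X"
      have "\<forall>i. \<exists>U. U \<in> \<U> \<and> (T ^^ i) x \<in> U"
      proof
        fix i
        have "(T ^^ i) x \<in> \<Union>\<U>"
          using iterate[OF x, of i] assms(1) by (simp only: open_cover_def)
        then show "\<exists>U. U \<in> \<U> \<and> (T ^^ i) x \<in> U"
          by blast
      qed
      from choice[OF this] obtain U where U: "\<forall>i. U i \<in> \<U> \<and> (T ^^ i) x \<in> U i" ..
      then have "?S U \<in> iterated_cover X T n \<U>"
        unfolding iterated_cover_def by (intro CollectI exI[of _ U]) simp
      moreover have "x \<in> ?S U"
        using x U by simp
      ultimately show "x \<in> \<Union>(iterated_cover X T n \<U>)"
        by blast
    qed
  qed
qed

lemma cover_number_witness:
  assumes "finite \<U>" "\<Union>\<U> = topspace X"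
  obtains \<V> where "\<V> \<subseteq> \<U>" "finite \<V>" "card \<V> = cover_number X \<U>" "\<Union>\<V> = topspace X"
proof -
  let ?P = "\<lambda>n. \<exists>\<V>\<subseteq>\<U>. finite \<V> \<and> card \<V> = n \<and> \<Union>\<V> = topspace X"
  have "?P (card \<U>)"
    using assms by (intro exI[of _ \<U>] conjI order_refl refl)
  then have "?P (cover_number X \<U>)"
    unfolding cover_number_def by (rule LeastI[of ?P])
  then show thesis
    using that by (elim exE conjE)
qed

text \<open>A member of the iterated cover contains at most one point of \<open>E\<close>, since two
  would share a member of \<open>\<U>\<close> at every time below \<open>n\<close>.\<close>

lemma card_le_cover_number:
  assumes "open_cover X \<U>" "finite \<U>" "T ` topspace X \<subseteq> topspace X" "E \<subseteq> topspace X"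
    and sep: "\<And>p q. p \<in> E \<Longrightarrow> q \<in> E \<Longrightarrow> p \<noteq> q \<Longrightarrow>
      \<exists>i<n. \<forall>U\<in>\<U>. \<not> ((T ^^ i) p \<in> U \<and> (T ^^ i) q \<in> U)"
  shows "card E \<le> cover_number X (iterated_cover X T n \<U>)"
proof -
  obtain \<V> where \<V>: "\<V> \<subseteq> iterated_cover X T n \<U>" "finite \<V>"
      "card \<V> = cover_number X (iterated_cover X T n \<U>)" "\<Union>\<V> = topspace X"
    using cover_number_witness[OF iterated_cover[OF assms(1-3)]] by blast
  have "\<forall>p\<in>E. \<exists>V. V \<in> \<V> \<and> p \<in> V"
    using assms(4) \<V>(4) by blast
  from bchoice[OF this] obtain v where v: "\<forall>p\<in>E. v p \<in> \<V> \<and> p \<in> v p" ..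
  have "inj_on v E"
  proof (rule inj_onI, rule ccontr)
    fix p q assume pq: "p \<in> E" "q \<in> E" "v p = v q" "p \<noteq> q"
    then have "v p \<in> iterated_cover X T n \<U>" "p \<in> v p" "q \<in> v p"
      using v \<V>(1) by auto
    then obtain U where U: "\<forall>i<n. U i \<in> \<U>" "\<forall>i<n. (T ^^ i) p \<in> U i" "\<forall>i<n. (T ^^ i) q \<in> U i"
      unfolding iterated_cover_def by blast
    obtain i where i: "i < n" "\<forall>U\<in>\<U>. \<not> ((T ^^ i) p \<in> U \<and> (T ^^ i) q \<in> U)"
      using sep[OF pq(1,2,4)] by blast
    with U show False
      using bspec[OF i(2), of "U i"] by simp
  qed
  moreover have "v ` E \<subseteq> \<V>"
    using v by blast
  ultimately have "card E \<le> card \<V>"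
    using \<V>(2) by (rule card_inj_on_le)
  then show ?thesis
    by (simp add: \<V>(3))
qed

text \<open>Growth known only at multiples of \<open>m\<close> is enough, because the upper limit
  along a subsequence bounds the full one from below.\<close>

lemma topological_entropy_ge_ln:
  assumes "open_cover X \<U>" "m > 0" "q > 0"
    and q: "\<And>k. q ^ k \<le> cover_number X (iterated_cover X T (m * k) \<U>)"
  shows "ereal (ln (real q) / real m) \<le> topological_entropy X T"
proof -
  let ?a = "\<lambda>n. ereal (ln (real (cover_number X (iterated_cover X T n \<U>))) / real n)"
  \<comment> \<open>Starting at \<open>Suc k\<close> avoids the index 0, so that the number of
    blocks can be cancelled.\<close>
  let ?r = "\<lambda>k. m * Suc k"
  have "ereal (ln (real q) / real m) \<le> ?a (?r k)" for k
  proof -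
    let ?N = "cover_number X (iterated_cover X T (?r k) \<U>)"
    have "real (q ^ Suc k) \<le> real ?N"
      using q[of "Suc k"] by (rule of_nat_mono)
    moreover have "0 < real (q ^ Suc k)"
      using \<open>q > 0\<close> by simp
    ultimately have "ln (real (q ^ Suc k)) \<le> ln (real ?N)"
      by (rule ln_mono)
    then have "ln (real (q ^ Suc k)) / real (?r k) \<le> ln (real ?N) / real (?r k)"
      by (rule divide_right_mono) (rule of_nat_0_le_iff)
    moreover have "ln (real (q ^ Suc k)) = real (Suc k) * ln (real q)"
      unfolding of_nat_power by (rule ln_realpow)
    moreover have "real (?r k) = real (Suc k) * real m"
      by (simp only: of_nat_mult mult.commute)
    ultimately show ?thesis
      by (simp only: mult_divide_mult_cancel_left of_nat_eq_0_iff nat.distinct not_False_eq_True ereal_less_eq(3))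
  qed
  then have "\<forall>\<^sub>F k in sequentially. ereal (ln (real q) / real m) \<le> (?a \<circ> ?r) k"
    unfolding comp_def by (rule always_eventually[OF allI])
  then have "ereal (ln (real q) / real m) \<le> limsup (?a \<circ> ?r)"
    by (rule le_Limsup[OF sequentially_bot])
  moreover have "strict_mono ?r"
    using \<open>m > 0\<close> by (simp add: strict_mono_def)
  then have "limsup (?a \<circ> ?r) \<le> limsup ?a"
    by (rule limsup_subseq_mono)
  ultimately have "ereal (ln (real q) / real m) \<le> limsup ?a"
    by (rule order_trans)
  also have "\<dots> = cover_entropy X T \<U>"
    by (simp only: cover_entropy_def)
  also have "\<dots> \<le> topological_entropy X T"
    unfolding topological_entropy_def by (rule SUP_upper) (rule CollectI, rule assms(1))
  finally show ?thesis .
qed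

context skew_product
begin

text \<open>The cover is chosen from \<open>\<eta>\<close> before \<open>k\<close>, so the same
  cover sees all orbit lengths. The separating times \<open>m * i\<close> with \<open>i < k\<close>
  fall among the \<open>m * k\<close> times of the iterated cover.\<close>

lemma topological_entropy_ge_separated:
  assumes "\<eta> > 0" "m > 0" "q > 0"
    and sep: "\<forall>k. \<exists>E\<subseteq>{0..1}. finite E \<and> q ^ k \<le> card E \<and>
      (\<forall>x\<in>E. \<forall>y\<in>E. x \<noteq> y \<longrightarrow> (\<exists>i<k. \<eta> \<le> \<bar>fibre_map (m * i) \<theta> x - fibre_map (m * i) \<theta> y\<bar>))"
  shows "ereal (ln (real q) / real m) \<le> topological_entropy (top_of_set Omega) F"
proof -
  have "\<exists>K. finite K \<and> K \<subseteq> {0..1} \<and> {0..1::real} \<subseteq> (\<Union>c\<in>K. ball c (\<eta> / 2))"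
    using compact_Icc \<open>\<eta> > 0\<close> by (simp add: seq_compact_imp_totally_bounded compact_imp_seq_compact)
  then obtain K where K: "finite K" "{0..1::real} \<subseteq> (\<Union>c\<in>K. ball c (\<eta> / 2))"
    by blast
  \<comment> \<open>Radius \<open>\<eta> / 2\<close> with open balls: heights in a common member
    differ by less than \<open>\<eta>\<close>.\<close>
  define \<U> where "\<U> = (\<lambda>c. Omega \<inter> UNIV \<times> ball c (\<eta> / 2)) ` K"
  have cover: "open_cover (top_of_set Omega) \<U>"
    unfolding open_cover_def
  proof
    show "\<forall>U\<in>\<U>. openin (top_of_set Omega) U"
      unfolding \<U>_def by (auto intro!: openin_open_Int open_Times)
    show "\<Union>\<U> = topspace (top_of_set Omega)"
      using K(2) unfolding \<U>_def Omega_def by auto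
  qed
  have fin: "finite \<U>"
    using K(1) by (simp add: \<U>_def)
  have F: "F ` topspace (top_of_set Omega) \<subseteq> topspace (top_of_set Omega)"
    using F_Omega by auto
  have "q ^ k \<le> cover_number (top_of_set Omega) (iterated_cover (top_of_set Omega) F (m * k) \<U>)" for k
  proof -
    from spec[OF sep, of k] obtain E where E: "E \<subseteq> {0..1}" "finite E" "q ^ k \<le> card E"
      "\<forall>x\<in>E. \<forall>y\<in>E. x \<noteq> y \<longrightarrow> (\<exists>i<k. \<eta> \<le> \<bar>fibre_map (m * i) \<theta> x - fibre_map (m * i) \<theta> y\<bar>)"
      by (elim exE conjE)
    have "card (Pair \<theta> ` E) \<le>
        cover_number (top_of_set Omega) (iterated_cover (top_of_set Omega) F (m * k) \<U>)"
    proof (rule card_le_cover_number[OF cover fin F])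
      show "Pair \<theta> ` E \<subseteq> topspace (top_of_set Omega)"
        using E(1) by (auto simp: Omega_def)
    next
      fix p p' assume "p \<in> Pair \<theta> ` E" "p' \<in> Pair \<theta> ` E" "p \<noteq> p'"
      then obtain x y where xy: "p = (\<theta>, x)" "p' = (\<theta>, y)" "x \<in> E" "y \<in> E" "x \<noteq> y"
        by blast
      then obtain i where i: "i < k" "\<eta> \<le> \<bar>fibre_map (m * i) \<theta> x - fibre_map (m * i) \<theta> y\<bar>"
        using E(4) by blast
      have "\<not> ((F ^^ (m * i)) p \<in> U \<and> (F ^^ (m * i)) p' \<in> U)" if "U \<in> \<U>" for U
      proof
        assume U: "(F ^^ (m * i)) p \<in> U \<and> (F ^^ (m * i)) p' \<in> U"
        from that obtain c where "U = Omega \<inter> UNIV \<times> ball c (\<eta> / 2)"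
          unfolding \<U>_def by blast
        with U have "fibre_map (m * i) \<theta> x \<in> ball c (\<eta> / 2)" "fibre_map (m * i) \<theta> y \<in> ball c (\<eta> / 2)"
          by (simp_all add: xy(1,2) fibre_map_def mem_Times_iff)
        then show False
          using i(2) unfolding mem_ball dist_real_def by linarith
      qed
      then show "\<exists>i<m * k. \<forall>U\<in>\<U>. \<not> ((F ^^ i) p \<in> U \<and> (F ^^ i) p' \<in> U)"
        using i(1) \<open>m > 0\<close> by (intro exI[of _ "m * i"]) simp
    qed
    moreover have "card (Pair \<theta> ` E) = card E"
      by (simp add: card_image inj_on_def)
    ultimately show ?thesis
      using E(3) by simp
  qed
  then show ?thesis
    by (rule topological_entropy_ge_ln[OF cover assms(2,3)])
qed

end

lemma ln_half_power_le:
  fixes s m q :: nat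
  assumes "s > 0" "m > 0" "s ^ m \<le> 2 * q"
  shows "ln (real s) - ln 2 / real m \<le> ln (real q) / real m"
proof -
  have "real (s ^ m) \<le> real (2 * q)"
    using assms(3) by (simp only: of_nat_le_iff)
  then have le: "real s ^ m \<le> 2 * real q"
    by simp
  have pos: "0 < real s ^ m"
    using assms(1) by simp
  then have "0 < real q"
    using le by linarith
  have "real m * ln (real s) = ln (real s ^ m)"
    by (rule ln_realpow[symmetric])
  also have "\<dots> \<le> ln (2 * real q)"
    using le pos by (rule ln_mono)
  also have "\<dots> = ln 2 + ln (real q)"
    using \<open>0 < real q\<close> by (intro ln_mult_pos) simp_all
  finally have "real m * ln (real s) - ln 2 \<le> ln (real q)"
    by simp
  then have "(real m * ln (real s) - ln 2) / real m \<le> ln (real q) / real m"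
    by (rule divide_right_mono) simp
  then show ?thesis
    using assms(2) by (simp add: diff_divide_distrib)
qed

section \<open>The entropy estimate as the block length grows\<close>

context horseshoe_on_fibres
begin

lemma topological_entropy_ge_power:
  assumes "m > 0"
  shows "ereal (ln (real ((s ^ m + 1) div 2)) / real m) \<le> topological_entropy (top_of_set Omega) F"
proof -
  define q where "q = (s ^ m + 1) div 2"
  have "s ^ m > 0"
    using card_\<D>(2) by simp
  then have "q > 0"
    unfolding q_def by linarith
  obtain \<eta> where "\<eta> > 0" and \<eta>: "\<forall>\<theta>\<in>G. \<forall>k. \<exists>E\<subseteq>{0..1}. finite E \<and> q ^ k \<le> card E \<and>
      (\<forall>x\<in>E. \<forall>y\<in>E. x \<noteq> y \<longrightarrow> (\<exists>i<k. \<eta> \<le> \<bar>fibre_map (m * i) \<theta> x - fibre_map (m * i) \<theta> y\<bar>))"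
    using separated_points[of m] unfolding q_def by (elim exE conjE)
  obtain \<theta> where "\<theta> \<in> G"
    using G_nonempty by blast
  then have "\<forall>k. \<exists>E\<subseteq>{0..1}. finite E \<and> q ^ k \<le> card E \<and>
      (\<forall>x\<in>E. \<forall>y\<in>E. x \<noteq> y \<longrightarrow> (\<exists>i<k. \<eta> \<le> \<bar>fibre_map (m * i) \<theta> x - fibre_map (m * i) \<theta> y\<bar>))"
    by (rule bspec[OF \<eta>])
  with \<open>\<eta> > 0\<close> assms \<open>q > 0\<close> show ?thesis
    unfolding q_def[symmetric] by (rule topological_entropy_ge_separated)
qed

lemma topological_entropy_ge:
  "ereal (ln (real s)) \<le> topological_entropy (top_of_set Omega) F"
proof (rule LIMSEQ_le_const2)
  \<comment> \<open>The loss from keeping half of the intervals in blocks of length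
    \<open>Suc n\<close>, a length that is never 0.\<close>
  have "(\<lambda>n. ln 2 / real (Suc n)) \<longlonglongrightarrow> 0"
    by (rule LIMSEQ_Suc[OF lim_const_over_n])
  from tendsto_diff[OF tendsto_const this, of "ln (real s)"]
  have "(\<lambda>n. ln (real s) - ln 2 / real (Suc n)) \<longlonglongrightarrow> ln (real s)"
    unfolding diff_0_right .
  then show "(\<lambda>n. ereal (ln (real s) - ln 2 / real (Suc n))) \<longlonglongrightarrow> ereal (ln (real s))"
    by (rule tendsto_ereal)
  have "ereal (ln (real s) - ln 2 / real (Suc n)) \<le> topological_entropy (top_of_set Omega) F" for n
  proof -
    have "s ^ Suc n \<le> 2 * ((s ^ Suc n + 1) div 2)"
      by linarith
    then have "ln (real s) - ln 2 / real (Suc n) \<le> ln (real ((s ^ Suc n + 1) div 2)) / real (Suc n)"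
      using card_\<D>(2) by (intro ln_half_power_le) simp_all
    then have "ereal (ln (real s) - ln 2 / real (Suc n)) \<le>
        ereal (ln (real ((s ^ Suc n + 1) div 2)) / real (Suc n))"
      by (simp only: ereal_less_eq(3))
    then show ?thesis
      using topological_entropy_ge_power[OF zero_less_Suc] by (rule order_trans)
  qed
  then show "\<exists>N. \<forall>n\<ge>N. ereal (ln (real s) - ln 2 / real (Suc n)) \<le> topological_entropy (top_of_set Omega) F"
    by (intro exI allI impI)
qed

end

theorem theorem2:
  fixes F :: "circle \<times> real \<Rightarrow> circle \<times> real" and s :: nat
  assumes "F \<in> skew_products"
    and "\<exists>J \<D>. horseshoe F s J \<D>"
  shows "topological_entropy (top_of_set Omega) F \<ge> ereal (ln (real s))"
proof -
  from assms(1) obtain \<omega> f where "\<omega> \<notin> \<rat>" "continuous_on Omega f" "f ` Omega \<subseteq> {0..1}"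
      "\<forall>\<theta>. \<forall>x\<in>{0..1}. F (\<theta>, x) = (rotation \<omega> \<theta>, f (\<theta>, x))"
    unfolding skew_products_def mem_Collect_eq by (elim exE conjE)
  then interpret skew_product F \<omega> f
    by unfold_locales simp_all
  from assms(2) obtain J \<D> where "horseshoe F s J \<D>"
    by (elim exE)
  then obtain G where "horseshoe_on_fibres F \<omega> f s J \<D> G"
    using horseshoe_on_generic_fibres by blast
  then show ?thesis
    by (rule horseshoe_on_fibres.topological_entropy_ge)
qed

end
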